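(* Let $\Omega\subset\mathbb{R}^2$ be a bounded domain with smooth boundary, let $u$ be the solution to $\Delta u=-2$ in $\Omega$, $u=0$ on $\partial\Omega$, and let $N$ be a connected component of $\Omega\setminus\mathrm{MAX}(u)$. Then the expected core radius $R(N)$ of $N$ is well defined (that is, $\overline\tau(N)\geq 1$) and nonnegative, $$R(N)\geq 0.$$ Moreover, the equality $R(N)=0$ holds if and only if $(\Omega,u)$ is equivalent, i.e. equal up to translations and rescaling, to Serrin's solution $(\Omega_0,u_0)$, where $\Omega_0=B(0,1)$ and $u_0(x)=\frac{1-|x|^2}{2}$.
   Context: A domain is a connected open set. Notation: $u_{\max}=\max_\Omega u$ and $\mathrm{MAX}(u)=\{p\in\Omega:u(p)=u_{\max}\}$. Rescaling: for $\lambda>0$, $(\Omega,u)$ is replaced by $(\lambda\Omega,\ \lambda^2u(\cdot/\lambda))$. Normalised wall shear stress (NWSS): for a connected component $\Gamma$ of $\partial\Omega$, $\overline\tau(\Gamma)=\dfrac{\max_\Gamma|\nabla u|}{\sqrt{2u_{\max}}}$; for a connected component $N$ of $\Omega\setminus\mathrm{MAX}(u)$, $\overline\tau(N)$ is the maximum of $\overline\tau(\Gamma)$ over the connected components $\Gamma$ of $\partial\Omega\cap\overline N$. For $0<R<1$ let $r_i(R)\in(0,R)$ be the smallest positive zero of $\rho\mapsto1-\rho^2+2R^2\log\rho$. Outer NWSS function $\overline\tau_o:[0,1)\to[1,\sqrt2)$: $\overline\tau_o(0)=1$ and $\overline\tau_o(R)=\dfrac{1-R^2}{\sqrt{1-R^2+2R^2\log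 R}}$ for $0<R<1$; it is continuous, strictly increasing and tends to $\sqrt2$ as $R\to1^-$. Inner NWSS function $\overline\tau_i:(0,1]\to[\sqrt2,+\infty)$: $\overline\tau_i(R)=\dfrac{R^2-r_i(R)^2}{r_i(R)\sqrt{1-R^2+2R^2\log R}}$ for $0<R<1$ and $\overline\tau_i(1)=\sqrt2$; it is continuous, strictly decreasing and tends to $+\infty$ as $R\to0^+$. Expected core radius of $N$: $R(N)=\overline\tau_o^{-1}(\overline\tau(N))$ if $\overline\tau(N)<\sqrt2$, and $R(N)=\overline\tau_i^{-1}(\overline\tau(N))$ if $\overline\tau(N)\geq\sqrt2$. (For the first case to make sense one needs $\overline\tau(N)\ge1$.) *)

theory Defs
  imports "HOL-Analysis.Analysis"
begin

definition partial_deriv :: "'a::euclidean_space \<Rightarrow> ('a \<Rightarrow> real) \<Rightarrow> 'a \<Rightarrow> real" where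
  "partial_deriv b f x = frechet_derivative f (at x) b"

definition grad :: "('a::euclidean_space \<Rightarrow> real) \<Rightarrow> 'a \<Rightarrow> 'a" where
  "grad f x = (\<Sum>b\<in>Basis. partial_deriv b f x *\<^sub>R b)"

definition laplacian :: "('a::euclidean_space \<Rightarrow> real) \<Rightarrow> 'a \<Rightarrow> real" where
  "laplacian f x = (\<Sum>b\<in>Basis. partial_deriv b (partial_deriv b f) x)"

text \<open>\<open>Ck_on k S f\<close>: \<open>f\<close> is of class \<open>C\<^sup>k\<close> on \<open>S\<close>; meant for open \<open>S\<close> only.\<close>

primrec Ck_on :: "nat \<Rightarrow> 'a::euclidean_space set \<Rightarrow> ('a \<Rightarrow> real) \<Rightarrow> bool" where
  "Ck_on 0 S f \<longleftrightarrow> continuous_on S f"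
| "Ck_on (Suc k) S f \<longleftrightarrow>
     (\<forall>x\<in>S. f differentiable (at x)) \<and> (\<forall>b\<in>Basis. Ck_on k S (partial_deriv b f))"

definition smooth_on :: "'a::euclidean_space set \<Rightarrow> ('a \<Rightarrow> real) \<Rightarrow> bool" where
  "smooth_on S f \<longleftrightarrow> (\<forall>k. Ck_on k S f)"

text \<open>Local defining functions. For open \<open>\<Omega>\<close> the condition forces \<open>\<rho>\<close> to vanish exactly on
  the part of the frontier in \<open>V\<close>, so \<open>\<Omega>\<close> lies on one side of its boundary (no slits or
  punctures).\<close>

definition smooth_boundary :: "'a::euclidean_space set \<Rightarrow> bool" where
  "smooth_boundary \<Omega> \<longleftrightarrow>
     (\<forall>p\<in>frontier \<Omega>. \<exists>V \<rho>. open V \<and> p \<in> V \<and> smooth_on V \<rho> \<and>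
        (\<forall>x\<in>V. grad \<rho> x \<noteq> 0) \<and> \<Omega> \<inter> V = {x\<in>V. \<rho> x < 0})"

text \<open>Classical solutions of the torsion problem, \<open>u \<in> C\<^sup>2(\<Omega>) \<inter> C\<^sup>1(closure \<Omega>)\<close>. The last
  regularity clause says that the gradient extends continuously to the closure, which is what
  gives \<open>\<nabla>u\<close> a meaning on the boundary; elliptic regularity provides it when the boundary is
  smooth. Values of \<open>u\<close> outside \<open>closure \<Omega>\<close> are irrelevant.\<close>

definition torsion_solution :: "'a::euclidean_space set \<Rightarrow> ('a \<Rightarrow> real) \<Rightarrow> bool" where
  "torsion_solution \<Omega> u \<longleftrightarrow>
     Ck_on 2 \<Omega> u \<and> continuous_on (closure \<Omega>) u \<and>
     (\<exists>G. continuous_on (closure \<Omega>) G \<and> (\<forall>x\<in>\<Omega>. G x = grad u x)) \<and>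
     (\<forall>x\<in>\<Omega>. laplacian u x = - 2) \<and> (\<forall>x\<in>frontier \<Omega>. u x = 0)"

text \<open>The gradient of \<open>u\<close> at points of \<open>closure \<Omega>\<close>, taken from inside \<open>\<Omega>\<close>.\<close>

definition grad_closure :: "'a::euclidean_space set \<Rightarrow> ('a \<Rightarrow> real) \<Rightarrow> 'a \<Rightarrow> 'a" where
  "grad_closure \<Omega> u p = Lim (at p within \<Omega>) (grad u)"

text \<open>Every maximum over \<open>\<Omega>\<close>, over a boundary component or over the boundary components of \<open>N\<close>
  is written as a supremum; it is attained for the objects of interest (\<open>closure \<Omega>\<close> is compact
  and there are finitely many boundary components).\<close>

definition u_max :: "'a set \<Rightarrow> ('a \<Rightarrow> real) \<Rightarrow> real" where
  "u_max \<Omega> u = (SUP x\<in>\<Omega>. u x)"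

definition max_set :: "'a set \<Rightarrow> ('a \<Rightarrow> real) \<Rightarrow> 'a set" where
  "max_set \<Omega> u = {p\<in>\<Omega>. u p = u_max \<Omega> u}"

definition NWSS_boundary :: "'a::euclidean_space set \<Rightarrow> ('a \<Rightarrow> real) \<Rightarrow> 'a set \<Rightarrow> real" where
  "NWSS_boundary \<Omega> u \<Gamma> = (SUP p\<in>\<Gamma>. norm (grad_closure \<Omega> u p)) / sqrt (2 * u_max \<Omega> u)"

definition NWSS :: "'a::euclidean_space set \<Rightarrow> ('a \<Rightarrow> real) \<Rightarrow> 'a set \<Rightarrow> real" where
  "NWSS \<Omega> u N = (SUP \<Gamma>\<in>components (frontier \<Omega> \<inter> closure N). NWSS_boundary \<Omega> u \<Gamma>)"

definition inner_radius :: "real \<Rightarrow> real" where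
  "inner_radius R = (LEAST \<rho>. 0 < \<rho> \<and> 1 - \<rho>\<^sup>2 + 2 * R\<^sup>2 * ln \<rho> = 0)"

definition tau_outer :: "real \<Rightarrow> real" where
  "tau_outer R = (if R = 0 then 1 else (1 - R\<^sup>2) / sqrt (1 - R\<^sup>2 + 2 * R\<^sup>2 * ln R))"

definition tau_inner :: "real \<Rightarrow> real" where
  "tau_inner R = (if R = 1 then sqrt 2
     else (R\<^sup>2 - (inner_radius R)\<^sup>2) / (inner_radius R * sqrt (1 - R\<^sup>2 + 2 * R\<^sup>2 * ln R)))"

definition expected_core_radius ::
    "'a::euclidean_space set \<Rightarrow> ('a \<Rightarrow> real) \<Rightarrow> 'a set \<Rightarrow> real" where
  "expected_core_radius \<Omega> u N =
     (if NWSS \<Omega> u N < sqrt 2 then inv_into {0..<1} tau_outer (NWSS \<Omega> u N)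
      else inv_into {0<..1} tau_inner (NWSS \<Omega> u N))"

text \<open>\<open>(\<Omega>, u)\<close> is a translate of the rescaling of \<open>(\<Omega>', u')\<close> by some \<open>l > 0\<close>.\<close>

definition equivalent_pairs ::
    "'a::euclidean_space set \<Rightarrow> ('a \<Rightarrow> real) \<Rightarrow> 'a set \<Rightarrow> ('a \<Rightarrow> real) \<Rightarrow> bool" where
  "equivalent_pairs \<Omega> u \<Omega>' u' \<longleftrightarrow>
     (\<exists>a l. l > 0 \<and> \<Omega> = (\<lambda>x. a + l *\<^sub>R x) ` \<Omega>' \<and>
        (\<forall>x\<in>closure \<Omega>. u x = l\<^sup>2 * u' ((1 / l) *\<^sub>R (x - a))))"

definition serrin_solution :: "'a::euclidean_space \<Rightarrow> real" where
  "serrin_solution x = (1 - (norm x)\<^sup>2) / 2"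

end

theory Submission
  imports Defs "HOL-Complex_Analysis.Complex_Analysis" "HOL-Real_Asymp.Real_Asymp"
begin

text \<open>Suppose that the NWSS of \<open>N\<close> is at most 1. The function \<open>P = \<bar>\<nabla>u\<bar>\<^sup>2 + 2u\<close> is subharmonic, because
  \<open>u\<^sub>x + x - \<i> (u\<^sub>y + y)\<close> is a holomorphic function \<open>F\<close> and \<open>P\<close> is locally \<open>\<bar>F\<bar>\<^sup>2\<close> plus the real part of
  a holomorphic function. Hence \<open>P \<le> 2 u\<^sub>m\<^sub>a\<^sub>x\<close> on \<open>N\<close>, with equality at the maximum points of \<open>u\<close>. Let
  \<open>p\<close> be such a point in the closure of \<open>N\<close>. If \<open>F' p \<noteq> 0\<close>, then \<open>P\<close> has a strict minimum at \<open>p\<close> along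
  the line on which the Hessian of \<open>u\<close> is most negative, and by concavity of \<open>u\<close> on nearby parallel
  lines \<open>N\<close> accumulates at this line on one side of \<open>p\<close>: a contradiction. If \<open>F' p = 0\<close>, then \<open>p\<close> is
  an isolated maximum point of \<open>u\<close>, a punctured neighbourhood of it lies in \<open>N\<close>, and the strong maximum
  principle makes \<open>P\<close> and then \<open>F\<close> constant, so that \<open>u\<close> is Serrin's solution.\<close>

section \<open>The NWSS functions\<close>

lemma ln_less_minus_one:
  fixes x :: real
  assumes "0 < x" "x \<noteq> 1"
  shows "ln x < x - 1"
  using assms ln_le_minus_one[of x] ln_eq_minus_one[of x] by force

text \<open>With \<open>x\<close> in the role of \<open>R\<^sup>2\<close> this is the radicand of
  \<open>tau_outer\<close>. It is positive because \<open>ln y < y - 1\<close> at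
  \<open>y = inverse x\<close>.\<close>

lemma tau_outer_radicand_pos:
  fixes x :: real
  assumes "0 < x" "x < 1"
  shows "1 - x + x * ln x > 0"
proof -
  have "- ln x = ln (inverse x)"
    using assms by (simp add: ln_inverse)
  also have "\<dots> < inverse x - 1"
    using assms by (intro ln_less_minus_one) auto
  finally have "x * (- ln x) < x * (inverse x - 1)"
    using assms by (intro mult_strict_left_mono)
  then show ?thesis
    using assms by (simp add: algebra_simps)
qed

lemma tau_outer_eq:
  assumes "0 < R"
  shows "tau_outer R = (1 - R\<^sup>2) / sqrt (1 - R\<^sup>2 + R\<^sup>2 * ln (R\<^sup>2))"
  using assms by (simp add: tau_outer_def ln_realpow algebra_simps)

text \<open>For \<open>x = R\<^sup>2\<close> the claim reduces to \<open>ln x < x - 1\<close>. It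
  makes \<open>R = 0\<close> the only radius in \<open>{0..<1}\<close> with outer value 1, which
  settles the equality case.\<close>

lemma tau_outer_gt_1:
  assumes "0 < R" "R < 1"
  shows "tau_outer R > 1"
proof -
  define x where "x = R\<^sup>2"
  have x: "0 < x" "x < 1"
    using assms by (simp_all add: x_def power_less_one_iff abs_square_less_1)
  have "ln x < x - 1"
    using x by (intro ln_less_minus_one) auto
  then have "x * ln x < x * (x - 1)"
    using x by simp
  then have "1 - x + x * ln x < (1 - x)\<^sup>2"
    by (simp add: power2_eq_square algebra_simps)
  then have "sqrt (1 - x + x * ln x) < 1 - x"
    using x real_less_lsqrt by simp
  then show ?thesis
    using tau_outer_radicand_pos[OF x] assms
    by (simp add: tau_outer_eq x_def)
qed

text \<open>\<open>inv_into\<close> gives a genuine preimage only for values in the image. The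
  intermediate value theorem supplies one, between the limits 1 at 0 and \<open>sqrt 2\<close> at
  1.\<close>

lemma tau_outer_surj:
  assumes "1 \<le> T" "T < sqrt 2"
  shows "T \<in> tau_outer ` {0..<1}"
proof (cases "T = 1")
  case True
  then show ?thesis by (auto simp: image_iff tau_outer_def intro!: bexI[of _ 0])
next
  case False
  have sqrt2_eq: "inverse ((1 / 2) powr (1 / 2)) = sqrt (2::real)"
    by (simp add: powr_half_sqrt real_sqrt_divide)
  define f where "f = (\<lambda>x::real. (1 - x) / sqrt (1 - x + x * ln x))"
  have "(f \<longlongrightarrow> 1) (at_right 0)" "(f \<longlongrightarrow> sqrt 2) (at_left 1)"
    using sqrt2_eq unfolding f_def by real_asymp+
  then have "\<forall>\<^sub>F x in at_right 0. f x < T" "\<forall>\<^sub>F x in at_left 1. T < f x"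
    using assms False by (auto intro: order_tendstoD)
  then obtain b c where b: "0 < b" "\<And>x. 0 < x \<Longrightarrow> x < b \<Longrightarrow> f x < T"
    and c: "c < 1" "\<And>x. c < x \<Longrightarrow> x < 1 \<Longrightarrow> T < f x"
    unfolding eventually_at_right_field eventually_at_left_field by blast
  define x0 where "x0 = min b 1 / 2"
  define x1 where "x1 = (max c x0 + 1) / 2"
  have x: "0 < x0" "x0 < x1" "x1 < 1" "f x0 < T" "T < f x1"
    using b c(1) by (auto simp: x0_def x1_def intro!: b(2) c(2))
  have "x \<noteq> 0 \<and> 1 - x + x * ln x \<noteq> 0" if "x \<in> {x0..x1}" for x
    using tau_outer_radicand_pos[of x] x that by auto
  then have "continuous_on {x0..x1} f"
    unfolding f_def by (intro continuous_intros) auto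
  then have "\<exists>x\<ge>x0. x \<le> x1 \<and> f x = T"
    using x(2,4,5) by (intro IVT') auto
  then obtain x where "x0 \<le> x" "x \<le> x1" "f x = T"
    by blast
  with x(1,3) have "0 < x" "x < 1" "f x = T"
    by simp_all
  then show ?thesis
    by (intro image_eqI[of _ _ "sqrt x"]) (auto simp: tau_outer_eq f_def)
qed

text \<open>With \<open>s = inner_radius R / R\<close> the value of \<open>tau_inner\<close> depends on \<open>s\<close> only, and \<open>R\<close> is
  recovered from \<open>s\<close> through \<open>1/R\<^sup>2 - ln (1/R\<^sup>2) = s\<^sup>2 - ln (s\<^sup>2)\<close>.\<close>

lemma inner_radius_eqI:
  assumes r: "0 < r" "r < R" and R: "R < 1" and zero: "1 - r\<^sup>2 + 2 * R\<^sup>2 * ln r = 0"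
  shows "inner_radius R = r"
  unfolding inner_radius_def
proof (rule Least_equality)
  show "0 < r \<and> 1 - r\<^sup>2 + 2 * R\<^sup>2 * ln r = 0" using r zero by simp
next
  fix y assume y: "0 < y \<and> 1 - y\<^sup>2 + 2 * R\<^sup>2 * ln y = 0"
  show "r \<le> y"
  proof (rule ccontr)
    assume "\<not> r \<le> y"
    then have yr: "y < r" by simp
    \<comment> \<open>Rolle: a zero \<open>y < r\<close> would give a critical point
      \<open>z\<close> between \<open>y\<close> and \<open>r\<close>, but the only positive critical
      point is \<open>R\<close>, which exceeds \<open>r\<close>.\<close>
    have "\<exists>z>y. z < r \<and> (1 - r\<^sup>2 + 2 * R\<^sup>2 * ln r) - (1 - y\<^sup>2 + 2 * R\<^sup>2 * ln y)
        = (r - y) * (- 2 * z + 2 * R\<^sup>2 / z)"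
      using y yr by (intro MVT2) (auto intro!: derivative_eq_intros simp: field_simps)
    then obtain z where z: "y < z" "z < r" "(r - y) * (- 2 * z + 2 * R\<^sup>2 / z) = 0"
      using y zero by auto
    then have "- 2 * z + 2 * R\<^sup>2 / z = 0"
      using yr by simp
    then have "z\<^sup>2 = R\<^sup>2"
      using y z(1) by (simp add: field_simps power2_eq_square)
    then show False
      using z y r by (simp add: power2_eq_iff)
  qed
qed

text \<open>Provides \<open>y = 1 / R\<^sup>2\<close> when \<open>R\<close> is to be recovered from
  \<open>s\<close>. The function is 1 at \<open>y = 1\<close> and tends to infinity.\<close>

lemma gt_one_in_image_minus_ln:
  fixes c :: real
  assumes "1 < c"
  obtains y where "1 < y" "y - ln y = c"
proof -
  have "filterlim (\<lambda>y::real. y - ln y) at_top at_top"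
    by real_asymp
  then have "\<forall>\<^sub>F y::real in at_top. c \<le> y - ln y"
    by (simp add: filterlim_at_top)
  then obtain b where b: "\<And>y. b \<le> y \<Longrightarrow> c \<le> y - ln y"
    unfolding eventually_at_top_linorder by blast
  have "continuous_on {1..max b 1} (\<lambda>y. y - ln y)"
    by (auto intro!: continuous_intros)
  then obtain y where y: "1 \<le> y" "y - ln y = c"
    using IVT'[of "\<lambda>y. y - ln y" 1 c "max b 1"] b assms by auto
  moreover have "y \<noteq> 1"
    using y assms by auto
  ultimately show ?thesis
    using that by force
qed

lemma tau_inner_surj:
  assumes "sqrt 2 \<le> T"
  shows "T \<in> tau_inner ` {0<..1}"
proof (cases "T = sqrt 2")
  case True
  then show ?thesis by (auto simp: image_iff tau_inner_def intro!: bexI[of _ 1])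
next
  case False
  have rad_pos: "0 < s\<^sup>2 - 1 - 2 * ln s" if "0 < s" "s < 1" for s :: real
  proof -
    have "s\<^sup>2 \<noteq> 1" using that by (simp add: power2_eq_1_iff)
    then have "ln (s\<^sup>2) < s\<^sup>2 - 1"
      using that by (intro ln_less_minus_one) auto
    then show ?thesis using that by (simp add: ln_realpow)
  qed
  have sqrt2_eq: "2 * inverse (2 powr (1 / 2)) = sqrt (2::real)"
    by (simp add: powr_half_sqrt real_div_sqrt flip: divide_inverse)
  \<comment> \<open>\<open>tau_inner R\<close> after the substitution
    \<open>inner_radius R = s * R\<close>, in which the factors \<open>R\<^sup>2\<close>
    cancel.\<close>
  define f where "f = (\<lambda>s::real. (1 - s\<^sup>2) / (s * sqrt (s\<^sup>2 - 1 - 2 * ln s)))"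
  have "filterlim f at_top (at_right 0)" "(f \<longlongrightarrow> sqrt 2) (at_left 1)"
    using sqrt2_eq unfolding f_def by real_asymp+
  then have "\<forall>\<^sub>F x in at_right 0. T < f x" "\<forall>\<^sub>F x in at_left 1. f x < T"
    using assms False by (auto simp: filterlim_at_top_dense intro: order_tendstoD)
  then obtain b c where b: "0 < b" "\<And>x. 0 < x \<Longrightarrow> x < b \<Longrightarrow> T < f x"
    and c: "c < 1" "\<And>x. c < x \<Longrightarrow> x < 1 \<Longrightarrow> f x < T"
    unfolding eventually_at_right_field eventually_at_left_field by blast
  define s0 where "s0 = min b 1 / 2"
  define s1 where "s1 = (max c s0 + 1) / 2"
  have x: "0 < s0" "s0 < s1" "s1 < 1" "T < f s0" "f s1 < T"
    using b c(1) by (auto simp: s0_def s1_def intro!: b(2) c(2))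
  have "s \<noteq> 0 \<and> s\<^sup>2 - 1 - 2 * ln s \<noteq> 0" if "s \<in> {s0..s1}" for s
    using rad_pos[of s] x that by auto
  then have "continuous_on {s0..s1} f"
    unfolding f_def by (intro continuous_intros) auto
  then have "\<exists>s\<ge>s0. s \<le> s1 \<and> f s = T"
    using x(2,4,5) by (intro IVT2') auto
  then obtain s where "s0 \<le> s" "s \<le> s1" "f s = T"
    by blast
  with x(1,3) have s: "0 < s" "s < 1" "f s = T"
    by simp_all
  then have "1 < s\<^sup>2 - ln (s\<^sup>2)"
    using rad_pos[of s] by (simp add: ln_realpow)
  then obtain y where y: "1 < y" "y - ln y = s\<^sup>2 - ln (s\<^sup>2)"
    by (rule gt_one_in_image_minus_ln)
  define R where "R = 1 / sqrt y"
  have R: "0 < R" "R < 1" "R\<^sup>2 = 1 / y" "ln R = - ln y / 2"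
    using y by (auto simp: R_def power_divide ln_div ln_sqrt)
  \<comment> \<open>Rearranged, this says that \<open>s * R\<close> is a zero of the function
    defining \<open>inner_radius R\<close>; it also turns the radicand into
    \<open>R\<^sup>2 * (s\<^sup>2 - 1 - 2 * ln s)\<close>.\<close>
  have key: "1 + 2 * R\<^sup>2 * ln R = R\<^sup>2 * (s\<^sup>2 - 2 * ln s)"
  proof -
    have "1 + 2 * R\<^sup>2 * ln R = R\<^sup>2 * (y - ln y)"
      using y(1) R(3) by (simp add: R(4) algebra_simps)
    then show ?thesis using y s by (simp add: ln_realpow)
  qed
  have "inner_radius R = s * R"
    using s R key by (intro inner_radius_eqI) (auto simp: ln_mult power_mult_distrib algebra_simps)
  moreover have "1 - R\<^sup>2 + 2 * R\<^sup>2 * ln R = R\<^sup>2 * (s\<^sup>2 - 1 - 2 * ln s)"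
    using key by (simp add: algebra_simps)
  then have "sqrt (1 - R\<^sup>2 + 2 * R\<^sup>2 * ln R) = R * sqrt (s\<^sup>2 - 1 - 2 * ln s)"
    using R(1) by (simp add: real_sqrt_mult)
  ultimately have "tau_inner R = (R\<^sup>2 - (s * R)\<^sup>2) / (s * R * (R * sqrt (s\<^sup>2 - 1 - 2 * ln s)))"
    using R(2) by (simp add: tau_inner_def)
  also have "\<dots> = (R\<^sup>2 * (1 - s\<^sup>2)) / (R\<^sup>2 * (s * sqrt (s\<^sup>2 - 1 - 2 * ln s)))"
    by (simp add: power2_eq_square algebra_simps)
  also have "\<dots> = f s"
    using R(1) by (simp add: f_def)
  finally show ?thesis
    using R s by (auto intro!: image_eqI[of _ _ R])
qed

lemma expected_core_radius_nonneg_eq_0_iff: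
  fixes \<Omega> N :: "'a::euclidean_space set"
  assumes "1 \<le> NWSS \<Omega> u N"
  shows "0 \<le> expected_core_radius \<Omega> u N"
    and "expected_core_radius \<Omega> u N = 0 \<longleftrightarrow> NWSS \<Omega> u N = 1"
proof -
  define T where "T = NWSS \<Omega> u N"
  define R where "R = expected_core_radius \<Omega> u N"
  have "0 \<le> R \<and> (R = 0 \<longleftrightarrow> T = 1)"
  proof (cases "T < sqrt 2")
    case True
    then have R: "R = inv_into {0..<1} tau_outer T"
      by (simp add: R_def T_def expected_core_radius_def)
    have "T \<in> tau_outer ` {0..<1}"
      using True assms by (intro tau_outer_surj) (simp_all add: T_def)
    then have "R \<in> {0..<1}" "tau_outer R = T"
      unfolding R by (rule inv_into_into, rule f_inv_into_f)
    moreover have "tau_outer 0 = 1"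
      by (simp add: tau_outer_def)
    ultimately show ?thesis
      using tau_outer_gt_1[of R] by (cases "R = 0") auto
  next
    case False
    then have R: "R = inv_into {0<..1} tau_inner T"
      by (simp add: R_def T_def expected_core_radius_def)
    \<comment> \<open>On the inner branch both sides of the equivalence are false, since
      \<open>R > 0\<close> and \<open>T \<ge> sqrt 2 > 1\<close>.\<close>
    have "R \<in> {0<..1}"
      unfolding R using False by (intro inv_into_into tau_inner_surj) simp
    moreover have "1 < sqrt 2" by simp
    ultimately show ?thesis
      using False by auto
  qed
  then show "0 \<le> expected_core_radius \<Omega> u N" "expected_core_radius \<Omega> u N = 0 \<longleftrightarrow> NWSS \<Omega> u N = 1"
    by (simp_all add: R_def T_def)
qed

section \<open>The torsion problem in the complex plane\<close>

lemma has_derivative_half_norm_square: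
  "((\<lambda>z. (cmod (z - p))\<^sup>2 / 2) has_derivative (\<lambda>w. Re (cnj (z - p) * w))) (at z)"
proof -
  have "((\<lambda>z. (z - p) \<bullet> (z - p)) has_derivative (\<lambda>w. (z - p) \<bullet> w + w \<bullet> (z - p))) (at z)"
    by (auto intro!: derivative_eq_intros)
  from has_derivative_mult_right[OF this, of "1 / 2"]
  have "((\<lambda>z. (cmod (z - p))\<^sup>2 / 2) has_derivative (\<lambda>w. (z - p) \<bullet> w)) (at z)"
    by (simp add: power2_norm_eq_inner inner_commute)
  then show ?thesis
    by (simp add: inner_complex_def algebra_simps)
qed

text \<open>Since \<open>norm (exp (K w)) = exp (Re (K w))\<close>, the maximum modulus principle
  for the exponential of \<open>K\<close> is the strong maximum principle for the harmonic function
  \<open>Re (K w)\<close>.\<close>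

lemma norm_exp_maximum_constant:
  assumes "K holomorphic_on ball q r" "z \<in> ball q r"
    and le: "\<And>w. w \<in> ball q r \<Longrightarrow> Re (K w) \<le> Re (K q)"
  shows "Re (K z) = Re (K q)"
proof -
  have q: "q \<in> ball q r"
    using assms(2) by (metis centre_in_ball dist_not_less_zero mem_ball not_le order.strict_trans1)
  have "(\<lambda>w. exp (K w)) constant_on ball q r"
    using q by (intro maximum_modulus_principle[where U = "ball q r" and \<xi> = q])
      (auto intro!: holomorphic_intros assms(1) le)
  then have "exp (K z) = exp (K q)"
    using assms(2) q unfolding constant_on_def by metis
  then have "norm (exp (K z)) = norm (exp (K q))" by simp
  then show ?thesis by simp
qed

lemma has_real_derivative_Re:
  assumes "(f has_vector_derivative d) (at t within S)"
  shows "((\<lambda>t. Re (f t)) has_real_derivative Re d) (at t within S)"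
  unfolding has_real_derivative_iff_has_vector_derivative
  by (rule bounded_linear.has_vector_derivative[OF bounded_linear_Re assms])

lemma open_Collect_less_on:
  fixes f g :: "'a::topological_space \<Rightarrow> real"
  assumes "open D" "continuous_on D f" "continuous_on D g"
  shows "open {z \<in> D. f z < g z}"
proof -
  have "open (D \<inter> (\<lambda>z. g z - f z) -` {0<..})"
    using assms by (intro continuous_open_preimage continuous_intros) auto
  also have "D \<inter> (\<lambda>z. g z - f z) -` {0<..} = {z \<in> D. f z < g z}"
    by auto
  finally show ?thesis .
qed

text \<open>A point of \<open>S\<close> in the closure of \<open>N\<close> has a ball inside
  \<open>S\<close>; being connected and meeting \<open>N\<close>, the ball lies in \<open>N\<close>.
  With \<open>S\<close> the set where \<open>u\<close> is below its maximum, \<open>N\<close> can be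
  left inside \<open>D\<close> only through maximum points.\<close>

lemma closure_component_Int_subset:
  fixes D :: "'a::real_normed_vector set"
  assumes "open S" "S \<subseteq> D" and N: "N \<in> components S"
  shows "closure N \<inter> D \<subseteq> N \<union> (D - S)"
proof
  fix q assume q: "q \<in> closure N \<inter> D"
  show "q \<in> N \<union> (D - S)"
  proof (rule ccontr)
    assume "q \<notin> N \<union> (D - S)"
    then have "q \<in> S" "q \<notin> N" using q by auto
    then obtain r where r: "0 < r" "ball q r \<subseteq> S"
      using \<open>open S\<close> open_contains_ball by blast
    have "N \<inter> ball q r \<noteq> {}"
      using q r(1) closure_approachable[of q N] by (force simp: dist_commute)
    then have "ball q r \<subseteq> N"
      by (intro components_maximal[OF N _ r(2)]) simp_all
    then show False using r(1) \<open>q \<notin> N\<close> centre_in_ball by blast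
  qed
qed

text \<open>Here \<open>F = u\<^sub>x + x - \<i> (u\<^sub>y + y)\<close> is the holomorphic derivative of the harmonic function
  \<open>u + \<bar>z\<bar>\<^sup>2/2\<close>, so that \<open>\<nabla>u\<close> corresponds to the conjugate of \<open>F z - cnj z\<close>.\<close>

locale planar_torsion =
  fixes D :: "complex set" and u :: "complex \<Rightarrow> real" and F :: "complex \<Rightarrow> complex"
  assumes open_D: "open D" and connected_D: "connected D"
    and holo_F: "F holomorphic_on D"
    and deriv_u: "\<And>z. z \<in> D \<Longrightarrow> (u has_derivative (\<lambda>w. Re ((F z - cnj z) * w))) (at z)"
begin

definition P :: "complex \<Rightarrow> real" where
  "P z = (cmod (F z - cnj z))\<^sup>2 + 2 * u z"

section \<open>Local holomorphic representation and maximum principles for \<open>u\<close> and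
  \<open>P\<close>\<close>

lemma deriv_F:
  assumes "z \<in> D"
  shows "(F has_field_derivative deriv F z) (at z)"
  using holo_F open_D assms by (simp add: holomorphic_derivI)

lemma continuous_on_u: "continuous_on D u"
  using deriv_u by (intro has_derivative_continuous_on) (auto intro: has_derivative_at_withinI)

lemma continuous_on_P: "continuous_on D P"
  unfolding P_def
  by (intro continuous_intros continuous_on_u holomorphic_on_imp_continuous_on holo_F)

text \<open>A ball is convex, so \<open>F\<close> has a primitive there, whose real part has the
  same derivative as \<open>u z + (cmod z)\<^sup>2 / 2\<close>; the constant difference is absorbed
  into the primitive.\<close>

lemma u_eq_Re_primitive:
  assumes "ball q r \<subseteq> D"
  obtains H where "\<And>z. z \<in> ball q r \<Longrightarrow> (H has_field_derivative F z) (at z)"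
    and "H holomorphic_on ball q r"
    and "\<And>z. z \<in> ball q r \<Longrightarrow> u z = Re (H z) - (cmod z)\<^sup>2 / 2"
proof -
  have "F holomorphic_on ball q r"
    using holo_F assms by (rule holomorphic_on_subset)
  then obtain H where H0: "\<And>z. z \<in> ball q r \<Longrightarrow> (H has_field_derivative F z) (at z within ball q r)"
    using holomorphic_convex_primitive'[of "ball q r" F] by auto
  then have holo_H: "H holomorphic_on ball q r"
    unfolding holomorphic_on_def field_differentiable_def by blast
  from H0 have H: "(H has_field_derivative F z) (at z)" if "z \<in> ball q r" for z
    using that by (metis at_within_open open_ball)
  define d where "d z = u z - (Re (H z) - (cmod z)\<^sup>2 / 2)" for z
  have d': "(d has_derivative (\<lambda>w. 0)) (at z)" if "z \<in> ball q r" for z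
  proof -
    have "((\<lambda>z. Re (H z)) has_derivative (\<lambda>w. Re (F z * w))) (at z)"
      using H[OF that] by (intro derivative_eq_intros) (auto simp: has_field_derivative_def)
    moreover have "((\<lambda>z. (cmod z)\<^sup>2 / 2) has_derivative (\<lambda>w. Re (cnj z * w))) (at z)"
      using has_derivative_half_norm_square[of 0 z] by simp
    ultimately have "(d has_derivative
        (\<lambda>w. Re ((F z - cnj z) * w) - (Re (F z * w) - Re (cnj z * w)))) (at z)"
      unfolding d_def using that assms by (intro has_derivative_diff deriv_u) auto
    then show ?thesis
      by (simp add: algebra_simps)
  qed
  have d: "d z = d q" if "z \<in> ball q r" for z
  proof (rule has_derivative_zero_unique_connected[OF _ _ d'])
    show "q \<in> ball q r"
      using that by (metis centre_in_ball dist_not_less_zero mem_ball not_le order.strict_trans1)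
  qed (use that in auto)
  show ?thesis
  proof (rule that[of "\<lambda>z. H z + complex_of_real (d q)"])
    show "(\<lambda>z. H z + complex_of_real (d q)) holomorphic_on ball q r"
      by (intro holomorphic_intros holo_H)
    fix z assume z: "z \<in> ball q r"
    show "((\<lambda>z. H z + complex_of_real (d q)) has_field_derivative F z) (at z)"
      using H[OF z] by (auto intro!: derivative_eq_intros)
    show "u z = Re (H z + complex_of_real (d q)) - (cmod z)\<^sup>2 / 2"
      using d[OF z] by (simp add: d_def)
  qed
qed

text \<open>Up to a constant, \<open>- u z - (cmod (z - q))\<^sup>2 / 2\<close> is the real part of
  a holomorphic function. If \<open>u\<close> were minimal at \<open>q\<close>, this would be
  maximal there and hence constant, although it is strictly smaller away from
  \<open>q\<close>.\<close>

lemma no_local_min: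
  assumes "0 < r" "ball q r \<subseteq> D" and min: "\<And>z. z \<in> ball q r \<Longrightarrow> u q \<le> u z"
  shows False
proof -
  obtain H where H: "\<And>z. z \<in> ball q r \<Longrightarrow> (H has_field_derivative F z) (at z)"
    and holo_H: "H holomorphic_on ball q r"
    and u: "\<And>z. z \<in> ball q r \<Longrightarrow> u z = Re (H z) - (cmod z)\<^sup>2 / 2"
    by (rule u_eq_Re_primitive[OF assms(2)]) blast
  define K where "K z = cnj q * z - H z" for z
  have ReK: "Re (K z) = - u z - (cmod (z - q))\<^sup>2 / 2 + (cmod q)\<^sup>2 / 2" if "z \<in> ball q r" for z
    using u[OF that] by (simp add: K_def cmod_power2) (simp add: power2_eq_square field_simps)
  have "K holomorphic_on ball q r"
    unfolding K_def using holo_H by (intro holomorphic_intros)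
  moreover have "Re (K z) \<le> Re (K q)" if "z \<in> ball q r" for z
  proof -
    have "Re (K q) = - u q + (cmod q)\<^sup>2 / 2"
      using ReK[of q] \<open>0 < r\<close> by simp
    then show ?thesis
      using ReK[OF that] min[OF that] zero_le_power2[of "cmod (z - q)"] by linarith
  qed
  moreover have z: "q + complex_of_real (r / 2) \<in> ball q r"
    using \<open>0 < r\<close> by (simp add: dist_norm)
  ultimately have "Re (K (q + complex_of_real (r / 2))) = Re (K q)"
    using norm_exp_maximum_constant by blast
  moreover have "Re (K q) = - u q + (cmod q)\<^sup>2 / 2"
    using ReK[of q] \<open>0 < r\<close> by simp
  moreover have "0 < (cmod (q + complex_of_real (r / 2) - q))\<^sup>2"
    using \<open>0 < r\<close> by simp
  ultimately show False
    using ReK[OF z] min[OF z] by linarith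
qed

text \<open>On a small ball \<open>P\<close> is \<open>\<bar>F - F q\<bar>\<^sup>2\<close> plus the real part of a holomorphic function, and both
  summands obey a maximum principle.\<close>

lemma F_constant_if_P_local_max:
  assumes "0 < r" "ball q r \<subseteq> D" and max: "\<And>z. z \<in> ball q r \<Longrightarrow> P z \<le> P q"
    and z: "z \<in> D"
  shows "F z = F q"
proof -
  obtain H where H: "\<And>z. z \<in> ball q r \<Longrightarrow> (H has_field_derivative F z) (at z)"
    and holo_H: "H holomorphic_on ball q r"
    and u: "\<And>z. z \<in> ball q r \<Longrightarrow> u z = Re (H z) - (cmod z)\<^sup>2 / 2"
    by (rule u_eq_Re_primitive[OF assms(2)]) blast
  \<comment> \<open>The terms \<open>(cmod z)\<^sup>2\<close> from the squared gradient and from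
    \<open>2 * u z\<close> cancel. Centring \<open>(cmod (F z))\<^sup>2\<close> at
    \<open>F q\<close> produces the first term of \<open>K\<close> and leaves a square that vanishes
    at \<open>q\<close>.\<close>
  define K where "K z = 2 * cnj (F q) * F z - 2 * z * F z + 2 * H z" for z
  have P: "P z = (cmod (F z - F q))\<^sup>2 - (cmod (F q))\<^sup>2 + Re (K z)" if "z \<in> ball q r" for z
    using u[OF that]
    by (simp add: P_def K_def cmod_power2) (simp add: power2_eq_square field_simps)
  have q: "q \<in> ball q r" using \<open>0 < r\<close> by simp
  have "F holomorphic_on ball q r"
    using holo_F assms(2) by (rule holomorphic_on_subset)
  with holo_H have K: "K holomorphic_on ball q r"
    unfolding K_def by (intro holomorphic_intros)
  have le: "(cmod (F z - F q))\<^sup>2 + Re (K z) \<le> Re (K q)" if "z \<in> ball q r" for z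
    using max[OF that] P[OF that] P[OF q] by simp
  have "Re (K z) \<le> Re (K q)" if "z \<in> ball q r" for z
    using le[OF that] zero_le_power2[of "cmod (F z - F q)"] by linarith
  \<comment> \<open>\<open>Re (K z)\<close> is maximal at \<open>q\<close>, hence constant, and then
    \<open>le\<close> leaves no room for the square.\<close>
  then have "Re (K z) = Re (K q)" if "z \<in> ball q r" for z
    using norm_exp_maximum_constant[OF K that] by blast
  then have F: "F z = F q" if "z \<in> ball q r" for z
    using le[OF that] that by fastforce
  \<comment> \<open>The identity theorem carries the equality from the ball to the connected set
    \<open>D\<close>.\<close>
  have "F z - F q = 0"
  proof (rule analytic_continuation[where f = "\<lambda>z. F z - F q" and U = "ball q r" and w = z])
    show "(\<lambda>z. F z - F q) holomorphic_on D"
      by (intro holomorphic_intros holo_F)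
    show "q islimpt ball q r"
      using \<open>0 < r\<close> by (simp add: islimpt_ball)
    show "\<And>z. z \<in> ball q r \<Longrightarrow> F z - F q = 0" using F by simp
  qed (use assms open_D connected_D q in auto)
  then show ?thesis by simp
qed

lemma F_eq_cnj_at_local_max:
  assumes "0 < r" "ball p r \<subseteq> D" and max: "\<And>z. z \<in> ball p r \<Longrightarrow> u z \<le> u p"
  shows "F p = cnj p"
proof -
  have "p \<in> D" using assms by auto
  have "(\<lambda>w. Re ((F p - cnj p) * w)) = (\<lambda>w. 0)"
    using assms by (intro differential_zero_maxmin[OF _ open_ball deriv_u[OF \<open>p \<in> D\<close>]]) auto
  \<comment> \<open>The vanishing derivative is tested in the direction
    \<open>cnj (F p - cnj p)\<close>, where it equals a squared modulus.\<close>
  then have "Re ((F p - cnj p) * cnj (F p - cnj p)) = 0"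
    by meson
  then show ?thesis
    by (simp only: complex_mult_cnj) (simp add: complex_eq_iff sum_power2_eq_zero_iff)
qed

section \<open>Behaviour of \<open>u\<close> and \<open>P\<close> along lines\<close>

lemma deriv_u_along_line:
  assumes "q + of_real t * e \<in> D"
  shows "((\<lambda>t. u (q + of_real t * e)) has_real_derivative
    Re ((F (q + of_real t * e) - cnj (q + of_real t * e)) * e)) (at t)"
proof -
  have "((\<lambda>t. q + complex_of_real t * e) has_derivative (\<lambda>h. of_real h * e)) (at t)"
    by (auto intro!: derivative_eq_intros)
  from has_derivative_compose[OF this deriv_u[OF assms]] show ?thesis
    by (simp add: has_field_derivative_def) (rule has_derivative_eq_rhs, assumption, auto simp: algebra_simps)
qed

lemma deriv_F_along_line:
  assumes "q + of_real t * e \<in> D"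
  shows "((\<lambda>t. F (q + of_real t * e) - cnj (q + of_real t * e)) has_vector_derivative
    deriv F (q + of_real t * e) * e - cnj e) (at t)"
proof -
  have "((\<lambda>t. q + complex_of_real t * e) has_vector_derivative e) (at t)"
    by (auto intro!: derivative_eq_intros simp: has_vector_derivative_def scaleR_conv_of_real)
  from field_vector_diff_chain_at[OF this deriv_F[OF assms]]
  have "((\<lambda>t. F (q + of_real t * e)) has_vector_derivative e * deriv F (q + of_real t * e)) (at t)"
    by (simp add: o_def)
  moreover have "((\<lambda>t. cnj (q + of_real t * e)) has_vector_derivative cnj e) (at t)"
    by (auto intro!: derivative_eq_intros simp: has_vector_derivative_def scaleR_conv_of_real)
  ultimately show ?thesis
    by (auto intro!: derivative_eq_intros simp: mult.commute)
qed

text \<open>Among unit vectors, \<open>e\<close> minimises the second derivative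
  \<open>Re (deriv F p * e\<^sup>2) - 1\<close> of \<open>u\<close>. In this direction the first
  derivative of \<open>P\<close> vanishes at \<open>p\<close> and the second is
  \<open>2 * ((cmod c)\<^sup>2 + cmod c) > 0\<close> with \<open>c = deriv F p\<close>.\<close>

lemma P_strict_min_along_line:
  assumes p: "p \<in> D" "F p = cnj p" and c: "deriv F p \<noteq> 0"
    and e: "cmod e = 1" "deriv F p * e\<^sup>2 = - of_real (cmod (deriv F p))"
  obtains d where "0 < d" "\<And>t. t \<noteq> 0 \<Longrightarrow> \<bar>t\<bar> < d \<Longrightarrow> P p < P (p + of_real t * e)"
proof -
  obtain r where r: "0 < r" "ball p r \<subseteq> D"
    using open_D p(1) open_contains_ball by blast
  have inD: "p + of_real t * e \<in> D" if "\<bar>t\<bar> < r" for t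
    using that r e(1) by (intro subsetD[OF r(2)]) (simp add: dist_norm norm_mult)
  define A where "A t = F (p + of_real t * e) - cnj (p + of_real t * e)" for t
  define B where "B t = deriv F (p + of_real t * e) * e" for t
  \<comment> \<open>The derivative of \<open>P\<close> along the line: the term with
    \<open>cnj e\<close> in the derivative of \<open>(cmod (A t))\<^sup>2\<close> cancels the
    derivative of \<open>2 * u\<close>.\<close>
  define g where "g t = 2 * Re (cnj (A t) * B t)" for t
  have A': "(A has_vector_derivative B t - cnj e) (at t)" if "\<bar>t\<bar> < r" for t
    using deriv_F_along_line[OF inD[OF that]] unfolding A_def B_def .
  have P': "((\<lambda>t. P (p + of_real t * e)) has_real_derivative g t) (at t)" if "\<bar>t\<bar> < r" for t
  proof -
    have "((\<lambda>t. cnj (A t) * A t) has_vector_derivative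
        cnj (A t) * (B t - cnj e) + cnj (B t - cnj e) * A t) (at t)"
      using A'[OF that] by (intro has_vector_derivative_mult has_vector_derivative_cnj)
    then have "((\<lambda>t. Re (cnj (A t) * A t)) has_real_derivative
        Re (cnj (A t) * (B t - cnj e) + cnj (B t - cnj e) * A t)) (at t)"
      by (intro has_real_derivative_Re)
    from DERIV_add[OF this DERIV_cmult[OF deriv_u_along_line[OF inD[OF that]], of 2]]
    have "((\<lambda>t. Re (cnj (A t) * A t) + 2 * u (p + of_real t * e)) has_real_derivative
        Re (cnj (A t) * (B t - cnj e) + cnj (B t - cnj e) * A t) + 2 * Re (A t * e)) (at t)"
      unfolding A_def .
    moreover have "Re (cnj (A t) * (B t - cnj e) + cnj (B t - cnj e) * A t) + 2 * Re (A t * e) = g t"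
      by (simp add: g_def algebra_simps)
    moreover have "Re (cnj (A t) * A t) + 2 * u (p + of_real t * e) = P (p + of_real t * e)" for t
      by (simp add: P_def A_def cmod_power2) (simp add: power2_eq_square algebra_simps)
    ultimately show ?thesis by simp
  qed
  have "(g has_real_derivative 2 * Re (cnj (deriv F p * e - cnj e) * (deriv F p * e))) (at 0)"
  proof -
    have "((\<lambda>t. p + complex_of_real t * e) has_vector_derivative e) (at 0)"
      by (auto intro!: derivative_eq_intros simp: has_vector_derivative_def scaleR_conv_of_real)
    moreover have "(deriv F has_field_derivative deriv (deriv F) p) (at (p + complex_of_real 0 * e))"
      using holomorphic_deriv[OF holo_F open_D] open_D p(1) by (simp add: holomorphic_derivI)
    ultimately have "(deriv F \<circ> (\<lambda>t. p + complex_of_real t * e) has_vector_derivative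
        e * deriv (deriv F) p) (at 0)"
      by (rule field_vector_diff_chain_at)
    then have "(B has_vector_derivative e * deriv (deriv F) p * e) (at 0)"
      unfolding B_def o_def by (intro has_vector_derivative_mult_left)
    then have "((\<lambda>t. cnj (A t) * B t) has_vector_derivative
        cnj (A 0) * (e * deriv (deriv F) p * e) + cnj (B 0 - cnj e) * B 0) (at 0)"
      using A'[of 0] r by (intro has_vector_derivative_mult has_vector_derivative_cnj) auto
    then have "((\<lambda>t. Re (cnj (A t) * B t)) has_real_derivative
        Re (cnj (A 0) * (e * deriv (deriv F) p * e) + cnj (B 0 - cnj e) * B 0)) (at 0)"
      by (intro has_real_derivative_Re)
    from DERIV_cmult[OF this, of 2] show ?thesis
      using p(2) unfolding g_def by (simp add: A_def B_def)
  qed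
  moreover have "Re (cnj (deriv F p * e - cnj e) * (deriv F p * e))
      = (cmod (deriv F p))\<^sup>2 + cmod (deriv F p)"
  proof -
    have "cnj (deriv F p * e - cnj e) * (deriv F p * e)
        = (deriv F p * e) * cnj (deriv F p * e) - deriv F p * e\<^sup>2"
      by (simp add: algebra_simps power2_eq_square)
    also have "\<dots> = of_real ((cmod (deriv F p))\<^sup>2 + cmod (deriv F p))"
      using e by (simp add: complex_norm_square[symmetric] norm_mult del: complex_cnj_mult)
    finally show ?thesis by simp
  qed
  moreover have "0 < cmod (deriv F p)" using c by simp
  ultimately have g': "(g has_real_derivative 2 * ((cmod (deriv F p))\<^sup>2 + cmod (deriv F p))) (at 0)"
    and pos: "0 < 2 * ((cmod (deriv F p))\<^sup>2 + cmod (deriv F p))"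
    by (simp_all only: zero_less_mult_iff add_nonneg_pos zero_le_power2 zero_less_numeral simp_thms)
  have "g 0 = 0" using p(2) by (simp add: g_def A_def)
  then obtain d1 d2 where d1: "0 < d1" "\<And>h. 0 < h \<Longrightarrow> h < d1 \<Longrightarrow> 0 < g h"
    and d2: "0 < d2" "\<And>h. 0 < h \<Longrightarrow> h < d2 \<Longrightarrow> g (- h) < 0"
    using DERIV_pos_inc_right[OF g' pos] DERIV_pos_inc_left[OF g' pos] by auto
  show ?thesis
  proof (rule that[of "min r (min d1 d2)"])
    fix t :: real assume t: "t \<noteq> 0" "\<bar>t\<bar> < min r (min d1 d2)"
    show "P p < P (p + of_real t * e)"
    proof (cases "0 < t")
      case True
      then obtain z where z: "0 < z" "z < t"
        "P (p + of_real t * e) - P (p + of_real 0 * e) = (t - 0) * g z"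
        using MVT2[of 0 t "\<lambda>t. P (p + of_real t * e)" g] P' t by auto
      then have "0 < (t - 0) * g z"
        using d1(2)[of z] t by simp
      then show ?thesis using z(3) by simp
    next
      case False
      then obtain z where z: "t < z" "z < 0"
        "P (p + of_real 0 * e) - P (p + of_real t * e) = (0 - t) * g z"
        using MVT2[of t 0 "\<lambda>t. P (p + of_real t * e)" g] P' t by auto
      then have "(0 - t) * g z < 0"
        using d2(2)[of "- z"] t by (simp add: mult_neg_neg zero_less_mult_iff)
      then show ?thesis using z(3) by simp
    qed
  qed (use r d1(1) d2(1) in auto)
qed

text \<open>If \<open>deriv F p = 0\<close>, the Hessian of \<open>u\<close> at \<open>p\<close> is
  minus the identity, so \<open>u\<close> decreases along every short ray from
  \<open>p\<close>.\<close>

lemma isolated_max: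
  assumes p: "p \<in> D" "F p = cnj p" "deriv F p = 0"
  obtains r where "0 < r" "ball p r \<subseteq> D" "\<And>z. z \<in> ball p r \<Longrightarrow> z \<noteq> p \<Longrightarrow> u z < u p"
proof -
  obtain r1 where r1: "0 < r1" "ball p r1 \<subseteq> D"
    using open_D p(1) open_contains_ball by blast
  have "(F has_derivative (\<lambda>h. 0)) (at p)"
    using deriv_F[OF p(1)] p(3) by (simp add: has_field_derivative_def lambda_zero)
  \<comment> \<open>The factor 1/2 leaves half of the quadratic decrease: at time \<open>t\<close>
    the derivative of \<open>u\<close> along the ray is at most
    \<open>- (t * (cmod e)\<^sup>2 / 2)\<close>.\<close>
  then obtain r2 where r2: "0 < r2" "\<And>z. norm (z - p) < r2 \<Longrightarrow> norm (F z - F p) \<le> 1 / 2 * norm (z - p)"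
    unfolding has_derivative_at_alt
    by (metis diff_zero half_gt_zero_iff zero_less_one)
  show ?thesis
  proof (rule that[of "min r1 r2"])
    fix z assume z: "z \<in> ball p (min r1 r2)" "z \<noteq> p"
    define e where "e = z - p"
    have e: "cmod e < r1" "cmod e < r2" "0 < cmod e"
      using z by (auto simp: e_def dist_norm norm_minus_commute)
    have small: "cmod (complex_of_real t * e) \<le> cmod e" if "0 \<le> t" "t \<le> 1" for t
      using that by (simp add: norm_mult mult_left_le_one_le)
    have inD: "p + of_real t * e \<in> D" if "0 \<le> t" "t \<le> 1" for t
      using small[OF that] e r1(2) by (intro subsetD[OF r1(2)]) (simp add: dist_norm)
    have "\<exists>t>0. t < 1 \<and> u (p + of_real 1 * e) - u (p + of_real 0 * e)
        = (1 - 0) * Re ((F (p + of_real t * e) - cnj (p + of_real t * e)) * e)"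
      by (intro MVT2[of 0 1 "\<lambda>t. u (p + of_real t * e)"] deriv_u_along_line inD) auto
    then obtain t where t: "0 < t" "t < 1" and eq: "u (p + of_real 1 * e) - u (p + of_real 0 * e)
        = (1 - 0) * Re ((F (p + of_real t * e) - cnj (p + of_real t * e)) * e)"
      by blast
    have "cmod (F (p + of_real t * e) - F p) \<le> 1 / 2 * (t * cmod e)"
      using r2(2)[of "p + of_real t * e"] small[of t] t e by (simp add: norm_mult)
    then have "cmod ((F (p + of_real t * e) - F p) * e) \<le> 1 / 2 * (t * cmod e) * cmod e"
      unfolding norm_mult by (intro mult_right_mono) auto
    then have "Re ((F (p + of_real t * e) - F p) * e) \<le> 1 / 2 * (t * cmod e) * cmod e"
      by (meson complex_Re_le_cmod order_trans)
    moreover have "(F (p + of_real t * e) - cnj (p + of_real t * e)) * e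
        = (F (p + of_real t * e) - F p) * e - of_real t * (e * cnj e)"
      using p(2) by (simp add: algebra_simps)
    then have "Re ((F (p + of_real t * e) - cnj (p + of_real t * e)) * e)
        = Re ((F (p + of_real t * e) - F p) * e) - t * (cmod e)\<^sup>2"
      by (simp add: complex_norm_square[symmetric] del: complex_cnj_mult)
    ultimately have "Re ((F (p + of_real t * e) - cnj (p + of_real t * e)) * e) \<le> - (t * (cmod e)\<^sup>2 / 2)"
      by (simp add: power2_eq_square)
    also have "\<dots> < 0" using t e by simp
    finally show "u z < u p" using eq by (simp add: e_def)
  qed (use r1 r2(1) in auto)
qed

text \<open>If both endpoints were outside \<open>N\<close>, the segment would meet the level
  \<open>M\<close> on either side of \<open>q\<close>. By \<open>conc\<close> the second derivative
  of \<open>u\<close> along the segment is at most 0, and concavity would force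
  \<open>u q \<ge> M\<close>.\<close>

lemma component_along_concave_line:
  assumes N: "N \<in> components (D - {z \<in> D. u z = M})" "q \<in> N"
    and le: "\<And>z. z \<in> D \<Longrightarrow> u z \<le> M"
    and e: "cmod e = 1" and \<delta>: "0 < \<delta>"
    and inD: "\<And>t. t \<in> {-\<delta>..\<delta>} \<Longrightarrow> q + of_real t * e \<in> D"
    and conc: "\<And>t. t \<in> {-\<delta>..\<delta>} \<Longrightarrow> Re (deriv F (q + of_real t * e) * e\<^sup>2) \<le> 1"
  shows "q + of_real \<delta> * e \<in> N \<or> q + of_real (- \<delta>) * e \<in> N"
proof (rule ccontr)
  define l where "l t = q + complex_of_real t * e" for t
  assume "\<not> ?thesis"
  then have notin: "l \<delta> \<notin> N" "l (- \<delta>) \<notin> N" by (simp_all add: l_def)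
  \<comment> \<open>A connected piece of the segment through \<open>q\<close> that avoids the level
    \<open>M\<close> stays in \<open>N\<close>, so a point outside \<open>N\<close> forces a
    hit.\<close>
  have seg: "\<exists>t\<in>S. u (l t) = M"
    if S: "connected S" "S \<subseteq> {-\<delta>..\<delta>}" "0 \<in> S" and t: "t \<in> S" "l t \<notin> N" for S t
  proof (rule ccontr)
    assume "\<not> (\<exists>t\<in>S. u (l t) = M)"
    then have "l ` S \<subseteq> D - {z \<in> D. u z = M}"
      using inD S(2) unfolding l_def by blast
    moreover have "connected (l ` S)"
      unfolding l_def by (intro connected_continuous_image continuous_intros S(1))
    moreover have "N \<inter> l ` S \<noteq> {}"
      using N(2) S(3) by (force simp: l_def)
    ultimately have "l ` S \<subseteq> N"
      by (intro components_maximal[OF N(1)])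
    then show False using t by blast
  qed
  obtain s where s: "s \<in> {0..\<delta>}" "u (l s) = M"
    using seg[of "{0..\<delta>}" \<delta>] \<delta> notin by auto
  obtain s' where s': "s' \<in> {-\<delta>..0}" "u (l s') = M"
    using seg[of "{-\<delta>..0}" "-\<delta>"] \<delta> notin by auto
  have q: "u (l 0) < M"
    using N le[of q] in_components_subset[OF N(1)] by (auto simp: l_def less_le)
  have D1: "((\<lambda>t. - u (l t)) has_real_derivative - Re ((F (l t) - cnj (l t)) * e)) (at t)"
    if "t \<in> {-\<delta>..\<delta>}" for t
    using DERIV_minus[OF deriv_u_along_line[OF inD[OF that]]] unfolding l_def .
  have D2: "((\<lambda>t. - Re ((F (l t) - cnj (l t)) * e)) has_real_derivative
      1 - Re (deriv F (l t) * e\<^sup>2)) (at t)" if "t \<in> {-\<delta>..\<delta>}" for t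
  proof -
    have "((\<lambda>t. (F (l t) - cnj (l t)) * e) has_vector_derivative
        (deriv F (l t) * e - cnj e) * e) (at t)"
      unfolding l_def by (intro has_vector_derivative_mult_left deriv_F_along_line inD[OF that])
    then have "((\<lambda>t. Re ((F (l t) - cnj (l t)) * e)) has_real_derivative
        Re ((deriv F (l t) * e - cnj e) * e)) (at t)"
      by (intro has_real_derivative_Re)
    moreover have "(deriv F (l t) * e - cnj e) * e = deriv F (l t) * e\<^sup>2 - e * cnj e"
      by (simp add: algebra_simps power2_eq_square)
    then have "- Re ((deriv F (l t) * e - cnj e) * e) = 1 - Re (deriv F (l t) * e\<^sup>2)"
      using e by (simp add: complex_norm_square[symmetric] del: complex_cnj_mult)
    ultimately show ?thesis
      using DERIV_minus by fastforce
  qed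
  have "convex_on {-\<delta>..\<delta>} (\<lambda>t. - u (l t))"
    by (rule f''_ge0_imp_convex[OF _ D1 D2]) (use conc in \<open>auto simp: l_def\<close>)
  then have "convex_on {s'..s} (\<lambda>t. - u (l t))"
    by (rule convex_on_subset) (use s s' in auto)
  then have "- u (l 0) \<le> max (- u (l s')) (- u (l s))"
    using s s' by (intro convex_on_le_max) auto
  then show False using q s s' by simp
qed

section \<open>Global consequences: positivity, the bound on \<open>P\<close> and the shape of
  \<open>D\<close>\<close>

lemma F_eq_cnj_at_max:
  assumes "p \<in> D" "\<And>z. z \<in> D \<Longrightarrow> u z \<le> u p"
  shows "F p = cnj p"
proof -
  obtain r where r: "0 < r" "ball p r \<subseteq> D"
    using open_D assms(1) open_contains_ball by blast
  show ?thesis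
    by (rule F_eq_cnj_at_local_max[OF r]) (use assms(2) r(2) in blast)
qed

text \<open>By \<open>no_local_min\<close> the minimum over the compact closure lies on the
  frontier, so it is 0. A zero inside \<open>D\<close> would again be an interior minimum.\<close>

lemma u_pos:
  assumes bdd: "bounded D" and cont: "continuous_on (closure D) u"
    and bd: "\<And>z. z \<in> frontier D \<Longrightarrow> u z = 0" and z: "z \<in> D"
  shows "0 < u z"
proof -
  have not_min: "\<not> (\<forall>w\<in>closure D. u q \<le> u w)" if q: "q \<in> D" for q
  proof
    assume le: "\<forall>w\<in>closure D. u q \<le> u w"
    obtain r where r: "0 < r" "ball q r \<subseteq> D"
      using open_D q open_contains_ball by blast
    then show False
      using no_local_min[OF r] le closure_subset by blast
  qed
  have "compact (closure D)" "closure D \<noteq> {}"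
    using bdd z by (auto simp: compact_closure)
  then obtain m where m: "m \<in> closure D" "\<forall>w\<in>closure D. u m \<le> u w"
    using continuous_attains_inf cont by blast
  then have "m \<notin> D" using not_min by blast
  then have "u m = 0" using m(1) bd open_D by (simp add: frontier_def interior_open)
  then have "\<forall>w\<in>closure D. 0 \<le> u w" using m(2) by simp
  then show ?thesis
    using not_min[OF z] z closure_subset by (metis in_mono less_eq_real_def)
qed

text \<open>The maximum over the compact closure is positive, so it is not taken on the
  frontier.\<close>

lemma max_attained:
  assumes bdd: "bounded D" and cont: "continuous_on (closure D) u"
    and bd: "\<And>z. z \<in> frontier D \<Longrightarrow> u z = 0" and ne: "D \<noteq> {}"
  obtains p where "p \<in> D" "\<And>z. z \<in> D \<Longrightarrow> u z \<le> u p"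
proof -
  have "compact (closure D)" "closure D \<noteq> {}"
    using bdd ne by (auto simp: compact_closure)
  then obtain p where p: "p \<in> closure D" "\<forall>w\<in>closure D. u w \<le> u p"
    using continuous_attains_sup cont by blast
  obtain z where z: "z \<in> D" using ne by blast
  have "0 < u z" using u_pos[OF bdd cont bd z] .
  also have "u z \<le> u p" using p(2) z closure_subset by blast
  finally have "p \<notin> frontier D" using bd by force
  then have "p \<in> D" using p(1) open_D by (simp add: frontier_def interior_open)
  then show ?thesis using that p(2) closure_subset by blast
qed

lemma F_constant_if_P_le_on_component:
  assumes p0: "p0 \<in> D" and le: "\<And>z. z \<in> D \<Longrightarrow> u z \<le> u p0"
    and N: "N \<in> components (D - {z \<in> D. u z = u p0})"
    and P_le: "\<And>z. z \<in> N \<Longrightarrow> P z \<le> 2 * u p0"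
  shows "\<exists>q. \<forall>z\<in>D. F z = F q"
proof -
  define S where "S = D - {z \<in> D. u z = u p0}"
  have S: "S = {z \<in> D. u z < u p0}"
    unfolding S_def using le by (auto simp: less_le)
  have "open S"
    unfolding S by (intro open_Collect_less_on open_D continuous_on_u continuous_intros)
  have NS: "N \<in> components S" using N by (simp add: S_def)
  have "N \<subseteq> S" using in_components_subset[OF NS] .
  have "open N" by (rule open_components[OF \<open>open S\<close> NS])
  have "N \<noteq> {}" using in_components_nonempty[OF NS] .
  have crit: "F p = cnj p" "P p = 2 * u p0" if "p \<in> D" "u p = u p0" for p
  proof -
    show "F p = cnj p"
      using le unfolding that(2)[symmetric] by (intro F_eq_cnj_at_max that(1))
    then show "P p = 2 * u p0" using that by (simp add: P_def)
  qed
  \<comment> \<open>Otherwise \<open>N\<close> would be open and closed in the connected set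
    \<open>D\<close>, hence equal to \<open>D\<close>, although \<open>p0\<close> is not in
    \<open>N\<close>.\<close>
  have "\<exists>p \<in> closure N \<inter> D. p \<notin> N"
  proof (rule ccontr)
    assume "\<not> ?thesis"
    then have "closure N \<inter> D = N"
      using \<open>N \<subseteq> S\<close> S closure_subset by blast
    then have "closedin (top_of_set D) N"
      by (metis closed_closure closedin_closed_Int inf_commute)
    moreover have "openin (top_of_set D) N"
      using \<open>open N\<close> \<open>N \<subseteq> S\<close> S by (auto intro: open_subset)
    ultimately have "N = D"
      using connected_D \<open>N \<noteq> {}\<close> connected_clopen by blast
    then show False using \<open>N \<subseteq> S\<close> S p0 by auto
  qed
  then obtain p where p: "p \<in> closure N" "p \<in> D" "p \<notin> N" by blast
  then have "p \<in> D - S"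
    using closure_component_Int_subset[OF \<open>open S\<close> _ NS, of D] S by blast
  then have up: "u p = u p0" using p(2) by (simp add: S_def)
  have near: "\<exists>q\<in>N. dist q p < r" if "0 < r" for r
    using p(1) that closure_approachable by blast
  show ?thesis
  proof (cases "deriv F p = 0")
    case True
    obtain r where r: "0 < r" "ball p r \<subseteq> D" "\<And>z. z \<in> ball p r \<Longrightarrow> z \<noteq> p \<Longrightarrow> u z < u p"
      using isolated_max[OF p(2) crit(1)[OF p(2) up] True] by blast
    have "ball p r - {p} \<subseteq> S" using r(2,3) up unfolding S by auto
    moreover have "connected (ball p r - {p})"
      by (rule connected_punctured_ball) simp
    moreover have "N \<inter> (ball p r - {p}) \<noteq> {}"
      using near[OF r(1)] p(3) by (force simp: dist_commute)
    ultimately have "ball p r - {p} \<subseteq> N"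
      by (intro components_maximal[OF NS]) auto
    then have "P z \<le> P p" if "z \<in> ball p r" for z
      using that P_le crit(2)[OF p(2) up] by (cases "z = p") auto
    then show ?thesis
      using F_constant_if_P_local_max[OF r(1,2)] by blast
  next
    case False
    define c where "c = deriv F p"
    have "cmod c \<noteq> 0" using False by (simp add: c_def)
    \<comment> \<open>This square root makes \<open>c * e\<^sup>2\<close> equal to
      \<open>- cmod c\<close>, the most negative value over unit vectors.\<close>
    define e where "e = csqrt (- cnj c / of_real (cmod c))"
    have "e\<^sup>2 = - cnj c / of_real (cmod c)" by (simp add: e_def)
    then have "c * e\<^sup>2 = - (c * cnj c) / of_real (cmod c)"
      by simp
    also have "\<dots> = - of_real (cmod c)"
      using \<open>cmod c \<noteq> 0\<close> by (simp flip: complex_norm_square add: power2_eq_square)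
    finally have ce: "c * e\<^sup>2 = - of_real (cmod c)" .
    have "(cmod e)\<^sup>2 = 1"
      using \<open>e\<^sup>2 = _\<close> \<open>cmod c \<noteq> 0\<close> by (simp add: norm_power[symmetric] norm_divide)
    then have e: "cmod e = 1" by (metis norm_ge_zero one_power2 power2_eq_imp_eq zero_le_one)
    obtain d where d: "0 < d" "\<And>t. t \<noteq> 0 \<Longrightarrow> \<bar>t\<bar> < d \<Longrightarrow> P p < P (p + of_real t * e)"
      using P_strict_min_along_line[OF p(2) crit(1)[OF p(2) up] False e] ce by (auto simp: c_def)
    have "continuous_on D (\<lambda>z. Re (deriv F z * e\<^sup>2))"
      by (intro continuous_intros holomorphic_on_imp_continuous_on holomorphic_deriv holo_F open_D)
    then have "open {z \<in> D. Re (deriv F z * e\<^sup>2) < 1}"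
      by (rule open_Collect_less_on[OF open_D _ continuous_on_const])
    moreover have "Re (c * e\<^sup>2) < 1"
      unfolding ce by simp (use norm_ge_zero[of c] in linarith)
    then have "p \<in> {z \<in> D. Re (deriv F z * e\<^sup>2) < 1}"
      using p(2) unfolding c_def by blast
    ultimately obtain r where r: "0 < r" "ball p r \<subseteq> {z \<in> D. Re (deriv F z * e\<^sup>2) < 1}"
      unfolding open_contains_ball by blast
    \<comment> \<open>\<open>\<delta> < d\<close> puts \<open>p + \<delta> e\<close> and
      \<open>p - \<delta> e\<close> in the range of the strict minimum of \<open>P\<close>; the
      thirds keep in \<open>ball p r\<close> the segment of half-length \<open>\<delta>\<close>
      about any \<open>q\<close> within \<open>r / 3\<close> of \<open>p\<close>.\<close>
    define \<delta> where "\<delta> = min d r / 3"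
    have \<delta>: "0 < \<delta>" "\<delta> < d" "\<delta> \<le> r / 3" using d(1) r(1) by (auto simp: \<delta>_def)
    have "open {z \<in> D. 2 * u p0 < P z}"
      by (intro open_Collect_less_on open_D continuous_on_P continuous_intros)
    moreover have "p + of_real t * e \<in> {z \<in> D. 2 * u p0 < P z}" if "t \<in> {\<delta>, -\<delta>}" for t
    proof -
      have "p + of_real t * e \<in> ball p r"
        using that \<delta> r(1) e by (auto simp: dist_norm norm_mult)
      then have "p + of_real t * e \<in> D" using r(2) by blast
      moreover have "P p < P (p + of_real t * e)"
        using that \<delta> by (intro d(2)) auto
      ultimately show ?thesis
        using crit(2)[OF p(2) up] by simp
    qed
    ultimately have "\<exists>\<eta>>0. ball (p + of_real t * e) \<eta> \<subseteq> {z \<in> D. 2 * u p0 < P z}"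
      if "t \<in> {\<delta>, -\<delta>}" for t
      using that unfolding open_contains_ball by blast
    \<comment> \<open>\<open>P\<close> exceeds \<open>2 * u p0\<close> on balls about these two
      points, hence at both endpoints of the segment through a nearby \<open>q\<close>. For
      \<open>q\<close> in \<open>N\<close> one endpoint is in \<open>N\<close>, against
      \<open>P_le\<close>.\<close>
    from this[of \<delta>] this[of "- \<delta>"] obtain \<eta>1 \<eta>2 where \<eta>: "0 < \<eta>1" "0 < \<eta>2"
      "ball (p + of_real \<delta> * e) \<eta>1 \<subseteq> {z \<in> D. 2 * u p0 < P z}"
      "ball (p + of_real (- \<delta>) * e) \<eta>2 \<subseteq> {z \<in> D. 2 * u p0 < P z}"
      by blast
    obtain q where q: "q \<in> N" "dist q p < min (r / 3) (min \<eta>1 \<eta>2)"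
      using near[of "min (r / 3) (min \<eta>1 \<eta>2)"] r(1) \<eta>(1,2) by auto
    have "q + of_real t * e \<in> {z \<in> D. Re (deriv F z * e\<^sup>2) < 1}" if "t \<in> {-\<delta>..\<delta>}" for t
    proof -
      have "cmod (q + of_real t * e - p) \<le> cmod (q - p) + cmod (of_real t * e)"
        using norm_triangle_ineq[of "q - p" "of_real t * e"] by (simp add: algebra_simps)
      also have "\<dots> < r"
        using that q(2) e \<delta>(3) by (auto simp: norm_mult dist_norm)
      finally show ?thesis
        using r(2) by (intro subsetD[OF r(2)]) (simp add: dist_norm norm_minus_commute)
    qed
    then have "q + of_real \<delta> * e \<in> N \<or> q + of_real (- \<delta>) * e \<in> N"
      using \<delta>(1) e le q(1) N
      by (intro component_along_concave_line[where M = "u p0"]) (auto simp: less_imp_le)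
    moreover have "q + of_real \<delta> * e \<in> ball (p + of_real \<delta> * e) \<eta>1"
      "q + of_real (- \<delta>) * e \<in> ball (p + of_real (- \<delta>) * e) \<eta>2"
      using q(2) by (simp_all add: dist_norm norm_minus_commute)
    ultimately have "\<exists>w\<in>N. 2 * u p0 < P w"
      using \<eta>(3,4) by blast
    then show ?thesis
      using P_le linorder_not_le by blast
  qed
qed

text \<open>\<open>P\<close> extends continuously to the compact closure of \<open>N\<close>. If its
  maximum is attained in \<open>N\<close>, the strong maximum principle applies. Otherwise it is
  attained at a maximum point of \<open>u\<close> or on the frontier, where \<open>u = 0\<close>;
  either way it is at most \<open>2 * u p0\<close>.\<close>

lemma F_constant_if_boundary_gradient_le:
  assumes bdd: "bounded D" and cont: "continuous_on (closure D) u"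
    and bd: "\<And>z. z \<in> frontier D \<Longrightarrow> u z = 0"
    and g: "continuous_on (closure D) g" "\<And>z. z \<in> D \<Longrightarrow> g z = cmod (F z - cnj z)"
    and p0: "p0 \<in> D" and le: "\<And>z. z \<in> D \<Longrightarrow> u z \<le> u p0"
    and N: "N \<in> components (D - {z \<in> D. u z = u p0})"
    and g_le: "\<And>z. z \<in> frontier D \<inter> closure N \<Longrightarrow> (g z)\<^sup>2 \<le> 2 * u p0"
    and z: "z \<in> D"
  shows "F z = cnj p0"
proof -
  define S where "S = D - {z \<in> D. u z = u p0}"
  have S: "S = {z \<in> D. u z < u p0}"
    unfolding S_def using le by (auto simp: less_le)
  have "open S"
    unfolding S by (intro open_Collect_less_on open_D continuous_on_u continuous_intros)
  have NS: "N \<in> components S" using N by (simp add: S_def)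
  have ND: "N \<subseteq> D" using in_components_subset[OF NS] S by blast
  have "open N" by (rule open_components[OF \<open>open S\<close> NS])
  have crit: "F p = cnj p" if "p \<in> D" "u p = u p0" for p
    using le unfolding that(2)[symmetric] by (intro F_eq_cnj_at_max that(1))
  define Q where "Q z = (g z)\<^sup>2 + 2 * u z" for z
  have Q: "Q z = P z" if "z \<in> D" for z
    using g(2)[OF that] by (simp add: Q_def P_def)
  have "compact (closure N)"
    using bounded_subset[OF bdd ND] by (simp add: compact_closure)
  moreover have "closure N \<noteq> {}"
    using in_components_nonempty[OF NS] by simp
  moreover have "continuous_on (closure N) Q"
    unfolding Q_def using closure_mono[OF ND]
    by (intro continuous_intros continuous_on_subset[OF cont] continuous_on_subset[OF g(1)])
  ultimately obtain q where q: "q \<in> closure N" "\<forall>z\<in>closure N. Q z \<le> Q q"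
    using continuous_attains_sup by blast
  have "\<exists>q. \<forall>z\<in>D. F z = F q"
  proof (cases "q \<in> N")
    case True
    then obtain r where r: "0 < r" "ball q r \<subseteq> N"
      using \<open>open N\<close> open_contains_ball by blast
    have "P z \<le> P q" if "z \<in> ball q r" for z
      using that r(2) q(2) ND True Q closure_subset by (metis in_mono)
    then show ?thesis
      using F_constant_if_P_local_max[OF r(1)] r(2) ND by blast
  next
    case False
    have "Q q \<le> 2 * u p0"
    proof (cases "q \<in> D")
      case True
      then have "u q = u p0"
        using closure_component_Int_subset[OF \<open>open S\<close> _ NS, of D] q(1) False
        by (auto simp: S_def)
      then show ?thesis
        using crit[OF True] Q[OF True] by (simp add: P_def)
    next
      case False
      then have "q \<in> frontier D"
        using q(1) closure_mono[OF ND] open_D by (auto simp: frontier_def interior_open)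
      then show ?thesis
        using bd g_le q(1) by (simp add: Q_def)
    qed
    then have "P z \<le> 2 * u p0" if "z \<in> N" for z
      using that q(2) ND Q closure_subset by (metis in_mono order_trans)
    then show ?thesis
      using F_constant_if_P_le_on_component[OF p0 le N] by blast
  qed
  then show ?thesis
    using z p0 crit[OF p0] by metis
qed

text \<open>The function \<open>u z + (cmod (z - p))\<^sup>2 / 2\<close> has zero derivative.
  Positivity of \<open>u\<close> then puts \<open>D\<close> inside the ball and \<open>u = 0\<close>
  puts its frontier on the sphere; the ball is connected, meets \<open>D\<close> and misses its
  frontier, so it lies in \<open>D\<close>.\<close>

lemma paraboloid_if_F_constant:
  assumes bdd: "bounded D" and cont: "continuous_on (closure D) u"
    and bd: "\<And>z. z \<in> frontier D \<Longrightarrow> u z = 0"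
    and p: "p \<in> D" and F: "\<And>z. z \<in> D \<Longrightarrow> F z = cnj p"
  shows "z \<in> closure D \<Longrightarrow> u z = u p - (cmod (z - p))\<^sup>2 / 2"
    and "D = ball p (sqrt (2 * u p))"
proof -
  define d where "d z = u z + (cmod (z - p))\<^sup>2 / 2" for z
  have d': "(d has_derivative (\<lambda>w. 0)) (at z)" if "z \<in> D" for z
  proof -
    from has_derivative_add[OF deriv_u[OF that] has_derivative_half_norm_square[of p z]] show ?thesis
      unfolding d_def using F[OF that] by (simp add: algebra_simps)
  qed
  have "d z = d p" if "z \<in> D" for z
    by (rule has_derivative_zero_unique_connected[OF open_D connected_D d' that p])
  then have "d z = u p" if "z \<in> D" for z
    using that by (simp add: d_def)
  moreover have "continuous_on (closure D) d"
    unfolding d_def by (intro continuous_intros cont) simp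
  ultimately have d: "d z = u p" if "z \<in> closure D" for z
    using continuous_constant_on_closure that by blast
  show "u z = u p - (cmod (z - p))\<^sup>2 / 2" if "z \<in> closure D"
    using d[OF that] by (simp add: d_def)
  define \<rho> where "\<rho> = sqrt (2 * u p)"
  have "0 < u p" using u_pos[OF bdd cont bd p] .
  have sq: "2 * u p = \<rho>\<^sup>2" "0 < \<rho>" using \<open>0 < u p\<close> by (simp_all add: \<rho>_def)
  have "z \<in> ball p \<rho>" if "z \<in> D" for z
  proof -
    have "0 < u z" using u_pos[OF bdd cont bd that] .
    then have "(cmod (z - p))\<^sup>2 < \<rho>\<^sup>2"
      using d[of z] that closure_subset sq(1) by (force simp: d_def)
    then show ?thesis
      using sq(2) by (simp add: dist_norm norm_minus_commute power2_less_imp_less)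
  qed
  moreover have "ball p \<rho> \<inter> frontier D = {}"
  proof -
    have "z \<notin> ball p \<rho>" if "z \<in> frontier D" for z
    proof -
      have "(cmod (z - p))\<^sup>2 = \<rho>\<^sup>2"
        using d[of z] bd[OF that] that sq(1) by (simp add: d_def frontier_def)
      then have "cmod (z - p) = \<rho>"
        by (rule power2_eq_imp_eq) (use sq(2) in auto)
      then show ?thesis by (simp add: dist_norm norm_minus_commute)
    qed
    then show ?thesis by blast
  qed
  then have "ball p \<rho> \<subseteq> D"
    using connected_Int_frontier[of "ball p \<rho>" D] p sq(2)
    by (metis Diff_eq_empty_iff IntI centre_in_ball connected_ball empty_iff)
  ultimately show "D = ball p (sqrt (2 * u p))"
    unfolding \<rho>_def by blast
qed

end

section \<open>Identification of the plane with the complex numbers\<close>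

lemma has_derivative_along_line:
  fixes f :: "'a::real_normed_vector \<Rightarrow> real"
  assumes "f differentiable (at (x + t *\<^sub>R v))"
  shows "((\<lambda>t. f (x + t *\<^sub>R v)) has_real_derivative frechet_derivative f (at (x + t *\<^sub>R v)) v) (at t)"
proof -
  have f: "(f has_derivative frechet_derivative f (at (x + t *\<^sub>R v))) (at (x + t *\<^sub>R v))"
    using assms frechet_derivative_works by blast
  have "((\<lambda>t. x + t *\<^sub>R v) has_derivative (\<lambda>h. h *\<^sub>R v)) (at t)"
    by (auto intro!: derivative_eq_intros)
  from has_derivative_compose[OF this f]
  have "((\<lambda>t. f (x + t *\<^sub>R v)) has_derivative
      (\<lambda>h. frechet_derivative f (at (x + t *\<^sub>R v)) (h *\<^sub>R v))) (at t)" .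
  moreover have "frechet_derivative f (at (x + t *\<^sub>R v)) (h *\<^sub>R v)
      = frechet_derivative f (at (x + t *\<^sub>R v)) v * h" for h
    using linear_frechet_derivative[OF assms] by (simp add: linear_cmul)
  ultimately show ?thesis
    unfolding has_field_derivative_def by simp
qed

text \<open>Two mean value steps, first along \<open>a\<close>, then along \<open>b\<close>. The
  second difference is symmetric in \<open>a\<close> and \<open>b\<close>, and the bound on
  \<open>t\<close> keeps the parallelogram in the ball.\<close>

lemma second_difference_mean_value:
  fixes f :: "'a::euclidean_space \<Rightarrow> real"
  assumes f: "\<And>y. y \<in> ball x r \<Longrightarrow> f differentiable (at y)"
    and fa: "\<And>y. y \<in> ball x r \<Longrightarrow> partial_deriv a f differentiable (at y)"
    and t: "0 < t" "t * (norm a + norm b) < r"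
  obtains y where "y \<in> ball x r"
    "f (x + t *\<^sub>R b + t *\<^sub>R a) - f (x + t *\<^sub>R a) - (f (x + t *\<^sub>R b) - f x)
      = t\<^sup>2 * partial_deriv b (partial_deriv a f) y"
proof -
  have inb: "x + \<tau> *\<^sub>R b + \<sigma> *\<^sub>R a \<in> ball x r" if "0 \<le> \<sigma>" "\<sigma> \<le> t" "0 \<le> \<tau>" "\<tau> \<le> t" for \<sigma> \<tau>
  proof -
    have "norm (\<tau> *\<^sub>R b + \<sigma> *\<^sub>R a) \<le> \<tau> * norm b + \<sigma> * norm a"
      using that norm_triangle_ineq[of "\<tau> *\<^sub>R b" "\<sigma> *\<^sub>R a"] by simp
    also have "\<dots> \<le> t * norm b + t * norm a"
      using that by (intro add_mono mult_right_mono) auto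
    also have "\<dots> < r" using t(2) by (simp add: algebra_simps)
    finally show ?thesis by (subst mem_ball, subst dist_commute) (simp add: dist_norm add.assoc)
  qed
  define g where "g \<sigma> = f (x + t *\<^sub>R b + \<sigma> *\<^sub>R a) - f (x + \<sigma> *\<^sub>R a)" for \<sigma>
  have "\<exists>\<sigma>>0. \<sigma> < t \<and> g t - g 0 = (t - 0) *
      (partial_deriv a f (x + t *\<^sub>R b + \<sigma> *\<^sub>R a) - partial_deriv a f (x + \<sigma> *\<^sub>R a))"
  proof (rule MVT2[OF t(1)])
    fix \<sigma> assume \<sigma>: "0 \<le> \<sigma>" "\<sigma> \<le> t"
    show "(g has_real_derivative partial_deriv a f (x + t *\<^sub>R b + \<sigma> *\<^sub>R a)
        - partial_deriv a f (x + \<sigma> *\<^sub>R a)) (at \<sigma>)"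
      unfolding g_def partial_deriv_def
      using inb[of \<sigma> t] inb[of \<sigma> 0] \<sigma> t(1)
      by (intro DERIV_diff has_derivative_along_line f) auto
  qed
  then obtain \<sigma> where \<sigma>: "0 < \<sigma>" "\<sigma> < t" "g t - g 0 = t *
      (partial_deriv a f (x + t *\<^sub>R b + \<sigma> *\<^sub>R a) - partial_deriv a f (x + \<sigma> *\<^sub>R a))"
    by auto
  have "\<exists>\<tau>>0. \<tau> < t \<and>
      partial_deriv a f (x + \<sigma> *\<^sub>R a + t *\<^sub>R b) - partial_deriv a f (x + \<sigma> *\<^sub>R a + 0 *\<^sub>R b)
      = (t - 0) * partial_deriv b (partial_deriv a f) (x + \<sigma> *\<^sub>R a + \<tau> *\<^sub>R b)"
  proof (rule MVT2[OF t(1)])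
    fix \<tau> assume "0 \<le> \<tau>" "\<tau> \<le> t"
    then show "((\<lambda>\<tau>. partial_deriv a f (x + \<sigma> *\<^sub>R a + \<tau> *\<^sub>R b)) has_real_derivative
        partial_deriv b (partial_deriv a f) (x + \<sigma> *\<^sub>R a + \<tau> *\<^sub>R b)) (at \<tau>)"
      unfolding partial_deriv_def[of b]
      using inb[of \<sigma> \<tau>] \<sigma>(1,2) by (intro has_derivative_along_line fa) (simp add: algebra_simps)
  qed
  then obtain \<tau> where \<tau>: "0 < \<tau>" "\<tau> < t"
      "partial_deriv a f (x + \<sigma> *\<^sub>R a + t *\<^sub>R b) - partial_deriv a f (x + \<sigma> *\<^sub>R a)
      = t * partial_deriv b (partial_deriv a f) (x + \<sigma> *\<^sub>R a + \<tau> *\<^sub>R b)"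
    by auto
  show ?thesis
  proof (rule that)
    show "x + \<sigma> *\<^sub>R a + \<tau> *\<^sub>R b \<in> ball x r"
      using inb[of \<sigma> \<tau>] \<sigma>(1,2) \<tau>(1,2) by (simp add: algebra_simps)
    show "f (x + t *\<^sub>R b + t *\<^sub>R a) - f (x + t *\<^sub>R a) - (f (x + t *\<^sub>R b) - f x)
        = t\<^sup>2 * partial_deriv b (partial_deriv a f) (x + \<sigma> *\<^sub>R a + \<tau> *\<^sub>R b)"
      using \<sigma>(3) \<tau>(3) by (simp add: g_def power2_eq_square algebra_simps)
  qed
qed

text \<open>The same second difference is expressed through either mixed derivative at points near
  \<open>x\<close>; continuity forces the two values at \<open>x\<close> to agree.\<close>

lemma partial_deriv_commute:
  fixes f :: "'a::euclidean_space \<Rightarrow> real"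
  assumes S: "open S" "x \<in> S" and f: "\<And>y. y \<in> S \<Longrightarrow> f differentiable (at y)"
    and fa: "\<And>y. y \<in> S \<Longrightarrow> partial_deriv a f differentiable (at y)"
    and fb: "\<And>y. y \<in> S \<Longrightarrow> partial_deriv b f differentiable (at y)"
    and fba: "continuous_on S (partial_deriv b (partial_deriv a f))"
    and fab: "continuous_on S (partial_deriv a (partial_deriv b f))"
  shows "partial_deriv b (partial_deriv a f) x = partial_deriv a (partial_deriv b f) x"
    (is "?g x = ?h x")
proof (rule ccontr)
  assume neq: "?g x \<noteq> ?h x"
  define \<epsilon> where "\<epsilon> = \<bar>?g x - ?h x\<bar> / 2"
  have "0 < \<epsilon>" using neq by (simp add: \<epsilon>_def)
  obtain r1 where r1: "0 < r1" "ball x r1 \<subseteq> S"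
    using S open_contains_ball by blast
  obtain r2 where r2: "0 < r2" "\<And>y. y \<in> S \<Longrightarrow> dist y x < r2 \<Longrightarrow> dist (?g y) (?g x) < \<epsilon>"
    using fba S(2) \<open>0 < \<epsilon>\<close> unfolding continuous_on_iff by metis
  obtain r3 where r3: "0 < r3" "\<And>y. y \<in> S \<Longrightarrow> dist y x < r3 \<Longrightarrow> dist (?h y) (?h x) < \<epsilon>"
    using fab S(2) \<open>0 < \<epsilon>\<close> unfolding continuous_on_iff by metis
  define r where "r = min r1 (min r2 r3)"
  have "0 < r" using r1 r2 r3 by (simp add: r_def)
  have rS: "ball x r \<subseteq> S" using r1(2) by (auto simp: r_def)
  define s where "s = norm a + norm b"
  have s: "0 < 2 * (s + 1)" "s < 2 * (s + 1)"
    using norm_ge_zero[of a] norm_ge_zero[of b] unfolding s_def by argo+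
  \<comment> \<open>The added 1 keeps the denominator positive even when \<open>a\<close> and
    \<open>b\<close> vanish.\<close>
  define t where "t = r / (2 * (s + 1))"
  have "0 < t"
    unfolding t_def using \<open>0 < r\<close> s(1) by (rule divide_pos_pos)
  moreover have "t * s < t * (2 * (s + 1))"
    using \<open>0 < t\<close> s(2) by (intro mult_strict_left_mono)
  moreover have "t * (2 * (s + 1)) = r"
    using nonzero_eq_divide_eq[of "2 * (s + 1)" t r] s(1) t_def by simp
  ultimately have t: "0 < t" "t * s < r"
    by (simp_all only:)
  obtain y where y: "y \<in> ball x r"
    "f (x + t *\<^sub>R b + t *\<^sub>R a) - f (x + t *\<^sub>R a) - (f (x + t *\<^sub>R b) - f x) = t\<^sup>2 * ?g y"
    by (rule second_difference_mean_value[of x r f a t b]) (use f fa t rS in \<open>auto simp: s_def\<close>)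
  obtain z where z: "z \<in> ball x r"
    "f (x + t *\<^sub>R a + t *\<^sub>R b) - f (x + t *\<^sub>R b) - (f (x + t *\<^sub>R a) - f x) = t\<^sup>2 * ?h z"
    by (rule second_difference_mean_value[of x r f b t a]) (use f fb t rS in \<open>auto simp: s_def add.commute\<close>)
  have "t\<^sup>2 * ?g y = t\<^sup>2 * ?h z"
    unfolding y(2)[symmetric] z(2)[symmetric] by (simp add: algebra_simps)
  then have "?g y = ?h z" using t(1) by simp
  moreover have "dist (?g y) (?g x) < \<epsilon>"
    by (rule r2(2)) (use y(1) rS in \<open>auto simp: r_def dist_commute\<close>)
  moreover have "dist (?h z) (?h x) < \<epsilon>"
    by (rule r3(2)) (use z(1) rS in \<open>auto simp: r_def dist_commute\<close>)
  ultimately have "\<bar>?g x - ?h x\<bar> < 2 * \<epsilon>"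
    by (simp add: dist_real_def)
  then show False by (simp add: \<epsilon>_def)
qed

section \<open>The linear isometry between \<open>real ^ 2\<close> and
  \<open>complex\<close>\<close>

definition vec_of :: "complex \<Rightarrow> real ^ 2" where
  "vec_of z = vector [Re z, Im z]"

definition complex_of :: "real ^ 2 \<Rightarrow> complex" where
  "complex_of x = Complex (x $ 1) (x $ 2)"

lemma vec_of_inverse [simp]: "complex_of (vec_of z) = z" "vec_of (complex_of x) = x"
  by (simp_all add: vec_of_def complex_of_def complex_eq_iff vec_eq_iff forall_2)

lemma linear_vec_of: "linear vec_of"
  by (rule linearI) (simp_all add: vec_of_def vec_eq_iff forall_2)

lemma linear_complex_of: "linear complex_of"
  by (rule linearI) (simp_all add: complex_of_def complex_eq_iff)

lemma norm_vec_of [simp]: "norm (vec_of z) = cmod z"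
  by (simp add: norm_vec_def L2_set_def sum_2 vec_of_def cmod_def)

lemma norm_complex_of [simp]: "cmod (complex_of x) = norm x"
  by (metis norm_vec_of vec_of_inverse(2))

lemma continuous_on_vec_of: "continuous_on S vec_of"
  by (simp add: linear_continuous_on linear_conv_bounded_linear[symmetric] linear_vec_of)

lemma continuous_on_complex_of: "continuous_on S complex_of"
  by (simp add: linear_continuous_on linear_conv_bounded_linear[symmetric] linear_complex_of)

lemma complex_of_diff: "complex_of (x - y) = complex_of x - complex_of y"
  by (rule linear_diff[OF linear_complex_of])

lemma complex_of_image: "complex_of ` S = vec_of -` S"
  by (force intro: rev_image_eqI)

lemma open_complex_of: "open S \<Longrightarrow> open (complex_of ` S)"
  unfolding complex_of_image by (rule open_vimage[OF _ continuous_on_vec_of])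

lemma inj_complex_of: "inj complex_of"
  by (metis injI vec_of_inverse(2))

lemma closure_complex_of: "closure (complex_of ` S) = complex_of ` closure S"
  using closure_injective_linear_image[OF linear_complex_of inj_complex_of] by (rule sym)

lemma frontier_complex_of:
  assumes "open S"
  shows "frontier (complex_of ` S) = complex_of ` frontier S"
  using open_complex_of[OF assms] assms
  by (simp add: frontier_def interior_open closure_complex_of image_set_diff[OF inj_complex_of])

lemma components_complex_of:
  assumes N: "N \<in> components S"
  shows "complex_of ` N \<in> components (complex_of ` S)"
  unfolding in_components_maximal
proof (intro conjI allI impI)
  show "complex_of ` N \<noteq> {}"
    using in_components_nonempty[OF N] by simp
  show "complex_of ` N \<subseteq> complex_of ` S"
    using in_components_subset[OF N] by (rule image_mono)
  show "connected (complex_of ` N)"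
    by (intro connected_continuous_image continuous_on_complex_of in_components_connected[OF N])
  fix C assume C: "C \<noteq> {} \<and> complex_of ` N \<subseteq> C \<and> C \<subseteq> complex_of ` S \<and> connected C"
  have "vec_of ` C \<subseteq> N"
  proof (rule components_maximal[OF N])
    show "connected (vec_of ` C)"
      using C by (intro connected_continuous_image continuous_on_vec_of) simp
    show "vec_of ` C \<subseteq> S"
      using C by auto
    obtain x where "x \<in> N" using in_components_nonempty[OF N] by blast
    moreover from this have "x \<in> vec_of ` C"
      using C by (intro image_eqI[of _ _ "complex_of x"]) auto
    ultimately show "N \<inter> vec_of ` C \<noteq> {}" by blast
  qed
  then have "complex_of ` vec_of ` C \<subseteq> complex_of ` N"
    by (rule image_mono)
  then show "C = complex_of ` N"
    using C by (simp add: image_image subset_antisym)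
qed

lemma Basis_real2: "(Basis :: (real ^ 2) set) = {axis 1 1, axis 2 1}"
  by (auto simp: Basis_vec_def UNIV_2)

lemma sum_Basis_real2: "(\<Sum>b\<in>(Basis :: (real ^ 2) set). f b) = f (axis 1 1) + f (axis 2 1)"
  by (simp add: Basis_real2 axis_eq_axis)

lemma vec_of_axis: "vec_of w = Re w *\<^sub>R axis 1 1 + Im w *\<^sub>R axis 2 1"
  by (simp add: vec_of_def vec_eq_iff forall_2 axis_def)

lemma complex_of_grad:
  "complex_of (grad f x) = Complex (partial_deriv (axis 1 1) f x) (partial_deriv (axis 2 1) f x)"
  by (simp add: grad_def sum_Basis_real2 complex_of_def axis_def)

lemma has_derivative_vec_of:
  assumes "f differentiable (at (vec_of z))"
  shows "((\<lambda>z. f (vec_of z)) has_derivative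
    (\<lambda>w. partial_deriv (axis 1 1) f (vec_of z) * Re w + partial_deriv (axis 2 1) f (vec_of z) * Im w)) (at z)"
proof -
  let ?f' = "frechet_derivative f (at (vec_of z))"
  have "(vec_of has_derivative vec_of) (at z)"
    using linear_vec_of by (simp add: linear_imp_has_derivative)
  moreover have "(f has_derivative ?f') (at (vec_of z))"
    using assms frechet_derivative_works by blast
  ultimately have "((\<lambda>z. f (vec_of z)) has_derivative (\<lambda>w. ?f' (vec_of w))) (at z)"
    by (rule has_derivative_compose)
  moreover have "?f' (vec_of w) = ?f' (axis 1 1) * Re w + ?f' (axis 2 1) * Im w" for w
    using linear_frechet_derivative[OF assms]
    by (simp add: vec_of_axis linear_add linear_cmul)
  ultimately show ?thesis by (simp add: partial_deriv_def)
qed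

text \<open>The Cauchy-Riemann equations for \<open>F\<close> are the equality of the mixed second
  derivatives of \<open>u\<close> and the equation \<open>laplacian u x = - 2\<close>.\<close>

lemma planar_torsion_torsion_solution:
  fixes \<Omega> :: "(real ^ 2) set"
  assumes "open \<Omega>" "connected \<Omega>" and sol: "torsion_solution \<Omega> u"
  shows "planar_torsion (complex_of ` \<Omega>) (\<lambda>z. u (vec_of z))
    (\<lambda>z. cnj (complex_of (grad u (vec_of z)) + z))"
    (is "planar_torsion ?D ?v ?F")
proof
  let ?ux = "partial_deriv (axis 1 1) u" and ?uy = "partial_deriv (axis 2 1) u"
  have C2: "Ck_on (Suc (Suc 0)) \<Omega> u" and lap: "\<And>x. x \<in> \<Omega> \<Longrightarrow> laplacian u x = - 2"
    using sol by (simp_all add: torsion_solution_def numeral_2_eq_2)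
  have diff: "u differentiable (at x)" "?ux differentiable (at x)" "?uy differentiable (at x)"
    if "x \<in> \<Omega>" for x
    using C2 that by (simp_all add: Basis_real2)
  have commute: "partial_deriv (axis 2 1) ?ux x = partial_deriv (axis 1 1) ?uy x" if "x \<in> \<Omega>" for x
    using C2 by (intro partial_deriv_commute[OF \<open>open \<Omega>\<close> that] diff) (simp_all add: Basis_real2)
  show "open ?D" using \<open>open \<Omega>\<close> by (rule open_complex_of)
  show "connected ?D"
    by (intro connected_continuous_image continuous_on_complex_of \<open>connected \<Omega>\<close>)
  show "(?v has_derivative (\<lambda>w. Re ((?F z - cnj z) * w))) (at z)" if "z \<in> ?D" for z
    using has_derivative_vec_of[of u z] diff(1)[of "vec_of z"] that
    by (auto simp: complex_of_grad)
  show "?F holomorphic_on ?D"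
    unfolding holomorphic_on_def field_differentiable_def
  proof
    fix z assume "z \<in> ?D"
    then have x: "vec_of z \<in> \<Omega>" by auto
    define \<alpha> \<beta> \<gamma> where "\<alpha> = partial_deriv (axis 1 1) ?ux (vec_of z)"
      and "\<beta> = partial_deriv (axis 2 1) ?ux (vec_of z)"
      and "\<gamma> = partial_deriv (axis 2 1) ?uy (vec_of z)"
    have \<gamma>: "\<gamma> = - 2 - \<alpha>"
      using lap[OF x] by (simp add: laplacian_def sum_Basis_real2 \<alpha>_def \<gamma>_def)
    have ux: "((\<lambda>z. ?ux (vec_of z)) has_derivative (\<lambda>w. \<alpha> * Re w + \<beta> * Im w)) (at z)"
      using has_derivative_vec_of[OF diff(2)[OF x]] by (simp add: \<alpha>_def \<beta>_def)
    have uy: "((\<lambda>z. ?uy (vec_of z)) has_derivative (\<lambda>w. \<beta> * Re w + \<gamma> * Im w)) (at z)"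
      using has_derivative_vec_of[OF diff(3)[OF x]] commute[OF x] by (simp add: \<beta>_def \<gamma>_def)
    have "((\<lambda>z. of_real (?ux (vec_of z) + Re z) - \<i> * of_real (?uy (vec_of z) + Im z)) has_derivative
        (\<lambda>w. of_real (\<alpha> * Re w + \<beta> * Im w + Re w) - \<i> * of_real (\<beta> * Re w + \<gamma> * Im w + Im w))) (at z)"
      by (intro has_derivative_diff has_derivative_mult_right has_derivative_of_real has_derivative_add
          ux uy bounded_linear.has_derivative[OF bounded_linear_Re] bounded_linear.has_derivative[OF bounded_linear_Im]
          has_derivative_ident)
    moreover have "(\<lambda>z. of_real (?ux (vec_of z) + Re z) - \<i> * of_real (?uy (vec_of z) + Im z)) = ?F"
      by (auto simp: complex_of_grad complex_eq_iff)
    moreover have "(\<lambda>w. of_real (\<alpha> * Re w + \<beta> * Im w + Re w) - \<i> * of_real (\<beta> * Re w + \<gamma> * Im w + Im w))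
        = (*) (Complex (\<alpha> + 1) (- \<beta>))"
      by (auto simp: complex_eq_iff \<gamma> algebra_simps)
    ultimately have "(?F has_field_derivative Complex (\<alpha> + 1) (- \<beta>)) (at z)"
      unfolding has_field_derivative_def by simp
    then show "\<exists>f'. (?F has_field_derivative f') (at z within ?D)"
      using has_field_derivative_at_within by blast
  qed
qed

section \<open>Rigidity\<close>

text \<open>A frontier point of an open set is a limit point of it, so the limit defining
  \<open>grad_closure\<close> is unique and any continuous extension of the gradient computes
  it.\<close>

lemma grad_closure_eq:
  assumes G: "continuous_on (closure \<Omega>) G" "\<And>x. x \<in> \<Omega> \<Longrightarrow> G x = grad u x"
    and "open \<Omega>" and p: "p \<in> frontier \<Omega>"
  shows "grad_closure \<Omega> u p = G p"
  unfolding grad_closure_def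
proof (rule tendsto_Lim)
  have p': "p \<in> closure \<Omega>" "p \<notin> \<Omega>"
    using p \<open>open \<Omega>\<close> by (auto simp: frontier_def interior_open)
  then show "\<not> trivial_limit (at p within \<Omega>)"
    by (auto simp: trivial_limit_within closure_def)
  have "(G \<longlongrightarrow> G p) (at p within closure \<Omega>)"
    using G(1) p'(1) unfolding continuous_on_def by blast
  then have "(G \<longlongrightarrow> G p) (at p within \<Omega>)"
    using closure_subset by (rule tendsto_within_subset)
  moreover have "\<forall>\<^sub>F x in at p within \<Omega>. G x = grad u x"
    using G(2) by (simp add: eventually_at_filter)
  ultimately show "(grad u \<longlongrightarrow> G p) (at p within \<Omega>)"
    using tendsto_cong by blast
qed

text \<open>A real supremum is an upper bound only for a set that is bounded above; the common bound
  \<open>B\<close> ensures this for both nested suprema.\<close>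

lemma NWSS_ge_boundary_gradient:
  assumes B: "\<And>q. q \<in> frontier \<Omega> \<Longrightarrow> norm (grad_closure \<Omega> u q) \<le> B"
    and "0 < u_max \<Omega> u" and p: "p \<in> frontier \<Omega> \<inter> closure N"
  shows "norm (grad_closure \<Omega> u p) / sqrt (2 * u_max \<Omega> u) \<le> NWSS \<Omega> u N"
proof -
  define X where "X = frontier \<Omega> \<inter> closure N"
  have sub: "\<Gamma> \<subseteq> frontier \<Omega>" "\<Gamma> \<noteq> {}" if "\<Gamma> \<in> components X" for \<Gamma>
    using in_components_subset[OF that] in_components_nonempty[OF that] by (auto simp: X_def)
  define \<Gamma> where "\<Gamma> = connected_component_set X p"
  have \<Gamma>: "\<Gamma> \<in> components X" "p \<in> \<Gamma>"
    using p by (auto simp: \<Gamma>_def X_def componentsI)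
  have "norm (grad_closure \<Omega> u p) \<le> (SUP q\<in>\<Gamma>. norm (grad_closure \<Omega> u q))"
    using \<Gamma>(2) sub(1)[OF \<Gamma>(1)] B by (intro cSUP_upper bdd_aboveI2[of _ _ B]) auto
  then have "norm (grad_closure \<Omega> u p) / sqrt (2 * u_max \<Omega> u) \<le> NWSS_boundary \<Omega> u \<Gamma>"
    using \<open>0 < u_max \<Omega> u\<close> unfolding NWSS_boundary_def by (intro divide_right_mono) auto
  also have "\<dots> \<le> NWSS \<Omega> u N"
    unfolding NWSS_def X_def[symmetric]
  proof (intro cSUP_upper \<Gamma>(1) bdd_aboveI2)
    fix \<Gamma>' assume \<Gamma>': "\<Gamma>' \<in> components X"
    have "(SUP q\<in>\<Gamma>'. norm (grad_closure \<Omega> u q)) \<le> B"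
      using sub[OF \<Gamma>'] B by (intro cSUP_least) auto
    then show "NWSS_boundary \<Omega> u \<Gamma>' \<le> B / sqrt (2 * u_max \<Omega> u)"
      using \<open>0 < u_max \<Omega> u\<close> unfolding NWSS_boundary_def by (intro divide_right_mono) auto
  qed
  finally show ?thesis .
qed

lemma u_max_eqI:
  assumes "p \<in> \<Omega>" "\<And>x. x \<in> \<Omega> \<Longrightarrow> u x \<le> u p"
  shows "u_max \<Omega> u = u p"
  unfolding u_max_def using assms by (intro cSup_eq_maximum) auto

section \<open>Comparison with Serrin's solution\<close>

lemma affine_image_unit_ball:
  fixes a :: "'a::real_normed_vector"
  assumes "0 < l"
  shows "(\<lambda>x. a + l *\<^sub>R x) ` ball 0 1 = ball a l"
proof (intro set_eqI iffI)
  fix x assume "x \<in> ball a l"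
  then show "x \<in> (\<lambda>x. a + l *\<^sub>R x) ` ball 0 1"
    using assms
    by (intro image_eqI[of _ _ "(1 / l) *\<^sub>R (x - a)"]) (simp_all add: dist_norm norm_minus_commute)
next
  fix x assume "x \<in> (\<lambda>x. a + l *\<^sub>R x) ` ball 0 1"
  then show "x \<in> ball a l" using assms by (auto simp: dist_norm)
qed

lemma rescaled_serrin_solution:
  assumes "0 < l"
  shows "l\<^sup>2 * serrin_solution ((1 / l) *\<^sub>R (x - a)) = (l\<^sup>2 - (norm (x - a))\<^sup>2) / 2"
  unfolding serrin_solution_def norm_scaleR power_mult_distrib
  using assms by (simp add: power_divide field_simps)

text \<open>In the complex plane the hypothesis says that the squared gradient is at most
  \<open>2 * u_max \<Omega> u\<close> on the frontier points in the closure of \<open>N\<close>.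
  Allowing equality with 1 serves both the lower bound and the equality case.\<close>

lemma NWSS_le_1_imp_serrin:
  fixes \<Omega> N :: "(real ^ 2) set"
  assumes \<Omega>: "open \<Omega>" "connected \<Omega>" "bounded \<Omega>" and sol: "torsion_solution \<Omega> u"
    and N: "N \<in> components (\<Omega> - max_set \<Omega> u)" and le1: "NWSS \<Omega> u N \<le> 1"
  shows "equivalent_pairs \<Omega> u (ball 0 1) serrin_solution"
proof -
  define D where "D = complex_of ` \<Omega>"
  define v where "v z = u (vec_of z)" for z
  define F where "F z = cnj (complex_of (grad u (vec_of z)) + z)" for z
  interpret planar_torsion D v F
    using planar_torsion_torsion_solution[OF \<Omega>(1,2) sol] unfolding D_def v_def F_def .
  obtain G where G: "continuous_on (closure \<Omega>) G" "\<And>x. x \<in> \<Omega> \<Longrightarrow> G x = grad u x"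
    and cont_u: "continuous_on (closure \<Omega>) u" and bd_u: "\<And>x. x \<in> frontier \<Omega> \<Longrightarrow> u x = 0"
    using sol unfolding torsion_solution_def by blast
  have clD: "closure D = complex_of ` closure \<Omega>" and frD: "frontier D = complex_of ` frontier \<Omega>"
    by (simp_all add: D_def closure_complex_of frontier_complex_of[OF \<Omega>(1)])
  have bdd: "bounded D"
    unfolding D_def using linear_complex_of \<Omega>(3)
    by (simp add: bounded_linear_image linear_conv_bounded_linear[symmetric])
  have cont: "continuous_on (closure D) v"
    unfolding v_def clD by (rule continuous_on_compose2[OF cont_u continuous_on_vec_of]) auto
  have bd: "v z = 0" if "z \<in> frontier D" for z
    using that bd_u by (auto simp: frD v_def)
  have "\<Omega> \<noteq> {}"
    using in_components_nonempty[OF N] in_components_subset[OF N] by blast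
  then have "D \<noteq> {}" by (simp add: D_def)
  obtain p where p: "p \<in> D" "\<And>z. z \<in> D \<Longrightarrow> v z \<le> v p"
    using max_attained[OF bdd cont bd \<open>D \<noteq> {}\<close>] by blast
  have vp: "0 < v p" using u_pos[OF bdd cont bd p(1)] .
  define a where "a = vec_of p"
  have a: "a \<in> \<Omega>" using p(1) by (auto simp: a_def D_def)
  have umax: "u_max \<Omega> u = v p"
  proof -
    have "u x \<le> u a" if "x \<in> \<Omega>" for x
      using p(2)[of "complex_of x"] that by (simp add: v_def a_def D_def)
    then show ?thesis using u_max_eqI[OF a] by (simp add: v_def a_def)
  qed
  define g where "g z = norm (G (vec_of z))" for z
  have "continuous_on (closure D) g"
    unfolding g_def clD
    by (intro continuous_on_norm continuous_on_compose2[OF G(1) continuous_on_vec_of]) auto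
  moreover have "g z = cmod (F z - cnj z)" if "z \<in> D" for z
  proof -
    have "F z - cnj z = cnj (complex_of (grad u (vec_of z)))" by (simp add: F_def)
    then show ?thesis
      using that G(2)[of "vec_of z"] by (auto simp: g_def D_def)
  qed
  moreover have "complex_of ` N \<in> components (D - {z \<in> D. v z = v p})"
  proof -
    have "complex_of ` (\<Omega> - max_set \<Omega> u) = D - {z \<in> D. v z = v p}"
      unfolding image_set_diff[OF inj_complex_of]
      by (auto simp: max_set_def umax D_def v_def)
    then show ?thesis using components_complex_of[OF N] by (simp only:)
  qed
  moreover have "(g z)\<^sup>2 \<le> 2 * v p" if z: "z \<in> frontier D \<inter> closure (complex_of ` N)" for z
  proof -
    have x: "vec_of z \<in> frontier \<Omega> \<inter> closure N"
    proof
      show "vec_of z \<in> frontier \<Omega>" using IntD1[OF z] by (auto simp: frD)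
      show "vec_of z \<in> closure N" using IntD2[OF z] by (auto simp: closure_complex_of)
    qed
    have gc: "grad_closure \<Omega> u q = G q" if "q \<in> frontier \<Omega>" for q
      by (rule grad_closure_eq[OF G \<Omega>(1) that])
    have "compact (closure \<Omega>)" using \<Omega>(3) by (simp add: compact_closure)
    then have "bounded (G ` closure \<Omega>)"
      using G(1) by (intro compact_imp_bounded compact_continuous_image)
    then obtain B where B: "\<And>q. q \<in> closure \<Omega> \<Longrightarrow> norm (G q) \<le> B"
      unfolding bounded_iff by blast
    have "norm (grad_closure \<Omega> u (vec_of z)) / sqrt (2 * u_max \<Omega> u) \<le> NWSS \<Omega> u N"
    proof (rule NWSS_ge_boundary_gradient[OF _ _ x])
      show "norm (grad_closure \<Omega> u q) \<le> B" if "q \<in> frontier \<Omega>" for q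
        using gc[OF that] B[of q] that by (simp add: frontier_def)
    qed (use umax vp in simp)
    then have "g z / sqrt (2 * v p) \<le> 1"
      using le1 gc[of "vec_of z"] x by (simp add: g_def umax)
    then have "g z \<le> sqrt (2 * v p)" using vp by simp
    then show ?thesis
      using vp power_mono[of "g z" "sqrt (2 * v p)" 2] by (simp add: g_def)
  qed
  ultimately have F: "F z = cnj p" if "z \<in> D" for z
    using F_constant_if_boundary_gradient_le[OF bdd cont bd _ _ p] that by blast
  note par = paraboloid_if_F_constant[OF bdd cont bd p(1) F]
  \<comment> \<open>The radius of the disc is also the scaling factor from the unit disc.\<close>
  define \<rho> where "\<rho> = sqrt (2 * v p)"
  have \<rho>: "0 < \<rho>" "\<rho>\<^sup>2 = 2 * v p" using vp by (simp_all add: \<rho>_def)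
  have norm_eq: "cmod (complex_of x - p) = norm (x - a)" for x
    by (metis a_def complex_of_diff norm_complex_of vec_of_inverse(1))
  have "\<Omega> = ball a \<rho>"
  proof -
    have "x \<in> \<Omega> \<longleftrightarrow> complex_of x \<in> D" for x
      by (simp add: D_def inj_image_mem_iff[OF inj_complex_of])
    then show ?thesis
      using par(2) norm_eq by (auto simp: \<rho>_def dist_norm norm_minus_commute)
  qed
  also have "\<dots> = (\<lambda>x. a + \<rho> *\<^sub>R x) ` ball 0 1"
    using \<rho>(1) by (rule affine_image_unit_ball[symmetric])
  finally have "\<Omega> = (\<lambda>x. a + \<rho> *\<^sub>R x) ` ball 0 1" .
  moreover have "u x = \<rho>\<^sup>2 * serrin_solution ((1 / \<rho>) *\<^sub>R (x - a))" if "x \<in> closure \<Omega>" for x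
  proof -
    have "v (complex_of x) = v p - (norm (x - a))\<^sup>2 / 2"
      using par(1)[of "complex_of x"] that norm_eq by (simp add: clD)
    then show ?thesis
      unfolding rescaled_serrin_solution[OF \<rho>(1)] using \<rho>(2) by (simp add: v_def field_simps)
  qed
  ultimately show ?thesis
    unfolding equivalent_pairs_def using \<rho>(1) by blast
qed

text \<open>Only the centre is a maximum point, and a punctured ball is connected in dimension at
  least 2, so it is all of \<open>N\<close>. The gradient has norm \<open>l\<close> on the sphere,
  and \<open>sqrt (2 * u_max \<Omega> u) = l\<close>.\<close>

lemma serrin_imp_NWSS_eq_1:
  fixes \<Omega> N :: "'a::euclidean_space set"
  assumes dim: "2 \<le> DIM('a)" and N: "N \<in> components (\<Omega> - max_set \<Omega> u)"
    and "equivalent_pairs \<Omega> u (ball 0 1) serrin_solution"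
  shows "NWSS \<Omega> u N = 1"
proof -
  obtain a l where l: "0 < l" and \<Omega>: "\<Omega> = (\<lambda>x. a + l *\<^sub>R x) ` ball 0 1"
    and u: "\<And>x. x \<in> closure \<Omega> \<Longrightarrow> u x = l\<^sup>2 * serrin_solution ((1 / l) *\<^sub>R (x - a))"
    using assms(3) unfolding equivalent_pairs_def by blast
  have ball: "\<Omega> = ball a l"
    unfolding \<Omega> using l by (rule affine_image_unit_ball)
  have u: "u x = (l\<^sup>2 - (norm (x - a))\<^sup>2) / 2" if "x \<in> \<Omega>" for x
    using u[OF subsetD[OF closure_subset that]] l by (simp only: rescaled_serrin_solution)
  have a: "a \<in> \<Omega>" using l by (simp add: ball)
  have umax: "u_max \<Omega> u = l\<^sup>2 / 2"
    using u_max_eqI[OF a, of u] u by (simp add: a)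
  have "max_set \<Omega> u = {a}"
    using a u by (auto simp: max_set_def umax)
  then have Nc: "N \<in> components (ball a l - {a})"
    using N by (simp add: ball)
  have "ball a l - {a} \<subseteq> N"
  proof (rule components_maximal[OF Nc connected_punctured_ball[OF dim] order_refl])
    show "N \<inter> (ball a l - {a}) \<noteq> {}"
      using in_components_nonempty[OF Nc] in_components_subset[OF Nc] by blast
  qed
  then have "N = ball a l - {a}"
    using in_components_subset[OF Nc] by blast
  then have ins: "insert a N = ball a l" using l by auto
  have fr: "frontier \<Omega> \<inter> closure N = sphere a l"
  proof -
    have "x \<in> closure N" if "x \<in> sphere a l" for x
    proof -
      \<comment> \<open>Putting the centre back gives the full ball, and a single point does not
        affect limit points.\<close>
      have "x islimpt insert a N" unfolding ins using that l by (simp add: islimpt_ball)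
      then show ?thesis by (simp add: islimpt_insert closure_def)
    qed
    then show ?thesis using l by (auto simp: ball frontier_ball)
  qed
  have grad: "grad u x = a - x" if "x \<in> \<Omega>" for x
  proof -
    have "((\<lambda>x. (l\<^sup>2 - (x - a) \<bullet> (x - a)) / 2) has_derivative (\<lambda>h. (a - x) \<bullet> h)) (at x)"
      by (auto intro!: derivative_eq_intros simp: inner_commute algebra_simps diff_divide_distrib)
    then have "(u has_derivative (\<lambda>h. (a - x) \<bullet> h)) (at x)"
    proof (rule has_derivative_transform_within_open)
      show "open \<Omega>" by (simp add: ball)
      show "x \<in> \<Omega>" by (rule that)
      show "(l\<^sup>2 - (y - a) \<bullet> (y - a)) / 2 = u y" if "y \<in> \<Omega>" for y
        using u[OF that] by (simp add: power2_norm_eq_inner)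
    qed
    then have "frechet_derivative u (at x) = (\<lambda>h. (a - x) \<bullet> h)"
      by (metis frechet_derivative_at)
    then show ?thesis
      unfolding grad_def partial_deriv_def by (simp add: euclidean_representation)
  qed
  have gc: "norm (grad_closure \<Omega> u q) = l" if "q \<in> sphere a l" for q
  proof -
    have "grad_closure \<Omega> u q = a - q"
      using that l grad by (intro grad_closure_eq continuous_intros) (auto simp: ball frontier_ball)
    then show ?thesis using that by (simp add: dist_norm)
  qed
  have "NWSS_boundary \<Omega> u \<Gamma> = 1" if "\<Gamma> \<in> components (sphere a l)" for \<Gamma>
  proof -
    have "(SUP q\<in>\<Gamma>. norm (grad_closure \<Omega> u q)) = (SUP q\<in>\<Gamma>. l)"
      using in_components_subset[OF that] gc by (intro SUP_cong) auto
    also have "\<dots> = l" using in_components_nonempty[OF that] by simp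
    finally show ?thesis using l by (simp add: NWSS_boundary_def umax)
  qed
  then have "NWSS \<Omega> u N = (SUP \<Gamma>\<in>components (sphere a l). 1)"
    unfolding NWSS_def fr by (intro SUP_cong) auto
  also have "\<dots> = 1" using l by simp
  finally show ?thesis .
qed

theorem theorem3:
  fixes \<Omega> N :: "(real ^ 2) set" and u :: "real ^ 2 \<Rightarrow> real"
  assumes "open \<Omega>" "connected \<Omega>" "bounded \<Omega>" "smooth_boundary \<Omega>"
    and "torsion_solution \<Omega> u"
    and "N \<in> components (\<Omega> - max_set \<Omega> u)"
  shows "NWSS \<Omega> u N \<ge> 1 \<and>
    expected_core_radius \<Omega> u N \<ge> 0 \<and>
    (expected_core_radius \<Omega> u N = 0 \<longleftrightarrow>
       equivalent_pairs \<Omega> u (ball 0 1) serrin_solution)"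
proof -
  note le = NWSS_le_1_imp_serrin[OF assms(1-3,5,6)]
  have eq: "NWSS \<Omega> u N = 1" if "equivalent_pairs \<Omega> u (ball 0 1) serrin_solution"
    using serrin_imp_NWSS_eq_1[OF _ assms(6) that] by simp
  \<comment> \<open>A value below 1 would force Serrin's solution, whose value is exactly 1.\<close>
  have "1 \<le> NWSS \<Omega> u N"
    using le eq by force
  moreover from this have "NWSS \<Omega> u N = 1 \<longleftrightarrow> equivalent_pairs \<Omega> u (ball 0 1) serrin_solution"
    using le eq by (metis order_refl)
  ultimately show ?thesis
    using expected_core_radius_nonneg_eq_0_iff[of \<Omega> u N] by metis
qed

end
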